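(* For every integer $n\ge 2$, the $\mathbb{Z}$-graded Lie superalgebra $HO(n,n)$ has no non-trivial filtered deformations; that is, every filtered deformation of $HO(n,n)$ is trivial.
   Context: All vector spaces and algebras are over $\mathbb{C}$. Filtered deformations. Let $\mathfrak{g}=\bigoplus_{j\ge -h}\mathfrak{g}_j$ ($h$ a positive integer) be a Lie superalgebra with a $\mathbb{Z}$-gradation compatible with its $\mathbb{Z}_2$-gradation, $[\mathfrak{g}_i,\mathfrak{g}_j]\subset\mathfrak{g}_{i+j}$, $\dim\mathfrak{g}_j<\infty$. Its completion is $\bar{\mathfrak{g}}=\prod_j\mathfrak{g}_j$, filtered by $\prod_{i\ge j}\mathfrak{g}_i$. A filtered Lie superalgebra of depth $h$ is a Lie superalgebra $L=L_{-h}\supset L_{-h+1}\supset\cdots\supset L_0\supset L_1\supset\cdots$ with $L_i$ subspaces compatible with the $\mathbb{Z}_2$-gradation, $[L_i,L_j]\subset L_{i+j}$, $\dim L_j/L_{j+1}<\infty$; it is assumed complete (and separated) in the topology defined by the filtration. A filtered deformation of $\mathfrak{g}$ is such an $L$ whose associated graded Lie superalgebra $\bigoplus_j L_j/L_{j+1}$ is isomorphic to $\mathfrak{g}$. It is trivial if it is isomorphic to $\bar{\mathfrak{g}}$ (as a filtered Lie superalgebra, i.e. one can choose complements $V_j$ of $L_{j+1}$ in $L_j$, identified with $\mathfrak{g}_j$, so that under $L=\prod_jV_j=\bar{\mathfrak{g}}$ the bracket of $L$ is that of $\bar{\mathfrak{g}}$). The algebra. Let $\Lambda(n,n)=\mathbb{C}[x_1,\dots,x_n]\otimes\Lambda(\xi_1,\dots,\xi_n)$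 with $x_i$ even and $\xi_i$ odd, with the Buttin bracket $$[f,g]=\sum_{i=1}^n\Big(\frac{\partial f}{\partial x_i}\frac{\partial g}{\partial\xi_i}+(-1)^{p(f)}\frac{\partial f}{\partial\xi_i}\frac{\partial g}{\partial x_i}\Big),$$ where $p(f)$ is the parity in $\Lambda(n,n)$. With reversed parity, $\Lambda(n,n)$ is a Lie superalgebra with center $\mathbb{C}1$, and $HO(n,n)=\Lambda(n,n)/\mathbb{C}1$ (with reversed parity); this is the Lie superalgebra of polynomial vector fields in $x_i,\xi_i$ annihilating $\sum_i dx_id\xi_i$. The $\mathbb{Z}$-gradation (of depth $1$) gives a polynomial homogeneous of total degree $d$ in the $x_i,\xi_i$ the degree $d-2$. *)

theory Defs
  imports Complex_Main "HOL-Library.Cardinality" "HOL-Library.Poly_Mapping" "HOL-Library.Z2"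
begin

section \<open>Lie superalgebras and filtered Lie superalgebras over the complex numbers\<close>

text \<open>The sign \<open>(-1)^(p q)\<close>. Parities live in the two-element field \<^typ>\<open>bit\<close>.\<close>

definition koszul :: "bit \<Rightarrow> bit \<Rightarrow> complex" where
  "koszul p q = (if p = 1 \<and> q = 1 then - 1 else 1)"

text \<open>The underlying vector space is a whole type; \<open>P 0\<close> and \<open>P 1\<close> are its even and odd parts.\<close>

locale lie_superalgebra = vector_space scale
  for scale :: "complex \<Rightarrow> 'a::ab_group_add \<Rightarrow> 'a" +
  fixes P :: "bit \<Rightarrow> 'a set" and br :: "'a \<Rightarrow> 'a \<Rightarrow> 'a"
  assumes parity_subspace: "subspace (P p)"
    and parity_disjoint: "P 0 \<inter> P 1 = {0}"
    and parity_sum: "\<exists>y\<in>P 0. \<exists>z\<in>P 1. x = y + z"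
    and bracket_linear_right: "Vector_Spaces.linear scale scale (\<lambda>y. br x y)"
    and bracket_linear_left: "Vector_Spaces.linear scale scale (\<lambda>x. br x y)"
    and bracket_parity: "x \<in> P p \<Longrightarrow> y \<in> P q \<Longrightarrow> br x y \<in> P (p + q)"
    and bracket_skew: "x \<in> P p \<Longrightarrow> y \<in> P q \<Longrightarrow> br x y = - scale (koszul p q) (br y x)"
    and bracket_jacobi: "x \<in> P p \<Longrightarrow> y \<in> P q \<Longrightarrow>
      br x (br y z) = br (br x y) z + scale (koszul p q) (br y (br x z))"

text \<open>
  A filtered Lie superalgebra of depth \<open>h\<close>. The filtration \<open>L\<close> is indexed by all integers, with the
  usual convention that \<open>L j\<close> is the whole algebra for \<open>j \<le> - h\<close>.
\<close>

locale filtered_lie_superalgebra = lie_superalgebra scale P br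
  for scale :: "complex \<Rightarrow> 'a::ab_group_add \<Rightarrow> 'a" and P :: "bit \<Rightarrow> 'a set"
    and br :: "'a \<Rightarrow> 'a \<Rightarrow> 'a" +
  fixes h :: int and L :: "int \<Rightarrow> 'a set"
  assumes depth_pos: "h > 0"
    and filt_subspace: "subspace (L j)"
    and filt_parity: "x \<in> L j \<Longrightarrow> \<exists>y\<in>L j \<inter> P 0. \<exists>z\<in>L j \<inter> P 1. x = y + z"
    and filt_top: "j \<le> - h \<Longrightarrow> L j = UNIV"
    and filt_decreasing: "L (j + 1) \<subseteq> L j"
    and filt_bracket: "x \<in> L i \<Longrightarrow> y \<in> L j \<Longrightarrow> br x y \<in> L (i + j)"
    and filt_finite_codim: "\<exists>B. finite B \<and> L j = span (B \<union> L (j + 1))"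
    and filt_separated: "(\<Inter>j. L j) = {0}"
    and filt_complete: "\<forall>X :: nat \<Rightarrow> 'a. (\<forall>j. \<exists>N. \<forall>m\<ge>N. \<forall>k\<ge>N. X m - X k \<in> L j) \<longrightarrow>
      (\<exists>x. \<forall>j. \<exists>N. \<forall>m\<ge>N. X m - x \<in> L j)"


section \<open>The associated graded Lie superalgebra\<close>

text \<open>
  Elements of the component \<open>L j / L (j + 1)\<close> are cosets, and the operations on the
  associated graded algebra are the induced operations on cosets, written elementwise.
\<close>

definition coset :: "'a::ab_group_add set \<Rightarrow> 'a \<Rightarrow> 'a set" where
  "coset W x = {x + w | w. w \<in> W}"

definition gr_comp :: "(int \<Rightarrow> 'a::ab_group_add set) \<Rightarrow> int \<Rightarrow> 'a set set" where
  "gr_comp L j = coset (L (j + 1)) ` L j"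

definition gr_parity ::
    "(bit \<Rightarrow> 'a::ab_group_add set) \<Rightarrow> (int \<Rightarrow> 'a set) \<Rightarrow> bit \<Rightarrow> int \<Rightarrow> 'a set set" where
  "gr_parity P L p j = coset (L (j + 1)) ` (L j \<inter> P p)"

definition gr_add :: "'a::ab_group_add set \<Rightarrow> 'a set \<Rightarrow> 'a set" where
  "gr_add A B = {a + b | a b. a \<in> A \<and> b \<in> B}"

definition gr_scale ::
    "(complex \<Rightarrow> 'a::ab_group_add \<Rightarrow> 'a) \<Rightarrow> (int \<Rightarrow> 'a set) \<Rightarrow> int \<Rightarrow> complex \<Rightarrow> 'a set \<Rightarrow> 'a set" where
  "gr_scale scale L j c A = {scale c a + w | a w. a \<in> A \<and> w \<in> L (j + 1)}"

definition gr_bracket ::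
    "('a::ab_group_add \<Rightarrow> 'a \<Rightarrow> 'a) \<Rightarrow> (int \<Rightarrow> 'a set) \<Rightarrow> int \<Rightarrow> int \<Rightarrow> 'a set \<Rightarrow> 'a set \<Rightarrow> 'a set" where
  "gr_bracket br L i j A B = {br a b + w | a b w. a \<in> A \<and> b \<in> B \<and> w \<in> L (i + j + 1)}"

text \<open>
  A graded Lie superalgebra is given by its scalar multiplication \<open>gscale\<close>, its even and odd parts
  \<open>gP\<close>, its bracket \<open>gbr\<close> and its graded components \<open>G\<close>. An isomorphism from the associated graded
  algebra of \<open>L\<close> onto it is a family \<open>\<phi>\<close> of isomorphisms between the components, as is
  any isomorphism of direct sums that preserves the gradations.
\<close>

definition gr_isomorphism ::
    "(complex \<Rightarrow> 'a::ab_group_add \<Rightarrow> 'a) \<Rightarrow> (bit \<Rightarrow> 'a set) \<Rightarrow> ('a \<Rightarrow> 'a \<Rightarrow> 'a) \<Rightarrow> (int \<Rightarrow> 'a set) \<Rightarrow>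
     (complex \<Rightarrow> 'g::ab_group_add \<Rightarrow> 'g) \<Rightarrow> (bit \<Rightarrow> 'g set) \<Rightarrow> ('g \<Rightarrow> 'g \<Rightarrow> 'g) \<Rightarrow> (int \<Rightarrow> 'g set) \<Rightarrow>
     (int \<Rightarrow> 'a set \<Rightarrow> 'g) \<Rightarrow> bool" where
  "gr_isomorphism scale P br L gscale gP gbr G \<phi> \<longleftrightarrow>
     (\<forall>j. bij_betw (\<phi> j) (gr_comp L j) (G j)) \<and>
     (\<forall>j. \<forall>A\<in>gr_comp L j. \<forall>B\<in>gr_comp L j. \<phi> j (gr_add A B) = \<phi> j A + \<phi> j B) \<and>
     (\<forall>j c. \<forall>A\<in>gr_comp L j. \<phi> j (gr_scale scale L j c A) = gscale c (\<phi> j A)) \<and>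
     (\<forall>j p. \<phi> j ` gr_parity P L p j = G j \<inter> gP p) \<and>
     (\<forall>i j. \<forall>A\<in>gr_comp L i. \<forall>B\<in>gr_comp L j.
        \<phi> (i + j) (gr_bracket br L i j A B) = gbr (\<phi> i A) (\<phi> j B))"

locale filtered_deformation = filtered_lie_superalgebra scale P br h L
  for scale :: "complex \<Rightarrow> 'a::ab_group_add \<Rightarrow> 'a" and P :: "bit \<Rightarrow> 'a set"
    and br :: "'a \<Rightarrow> 'a \<Rightarrow> 'a" and h :: int and L :: "int \<Rightarrow> 'a set" +
  fixes gscale :: "complex \<Rightarrow> 'g::ab_group_add \<Rightarrow> 'g" and gP :: "bit \<Rightarrow> 'g set"
    and gbr :: "'g \<Rightarrow> 'g \<Rightarrow> 'g" and G :: "int \<Rightarrow> 'g set"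
  assumes associated_graded: "\<exists>\<phi>. gr_isomorphism scale P br L gscale gP gbr G \<phi>"


section \<open>The completion of a graded Lie superalgebra, and triviality\<close>

text \<open>
  Elements of the completion are arbitrary families of homogeneous components, with
  componentwise addition and scalar multiplication. In the bracket, components of degree below
  \<open>- h\<close> vanish, so that the sum over \<open>i + j = k\<close> is finite.
\<close>

definition completion :: "(int \<Rightarrow> 'g set) \<Rightarrow> (int \<Rightarrow> 'g) set" where
  "completion G = {f. \<forall>j. f j \<in> G j}"

definition completion_filt :: "(int \<Rightarrow> 'g::zero set) \<Rightarrow> int \<Rightarrow> (int \<Rightarrow> 'g) set" where
  "completion_filt G j = {f \<in> completion G. \<forall>i<j. f i = 0}"

definition completion_parity ::
    "(bit \<Rightarrow> 'g set) \<Rightarrow> (int \<Rightarrow> 'g set) \<Rightarrow> bit \<Rightarrow> (int \<Rightarrow> 'g) set" where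
  "completion_parity gP G p = {f \<in> completion G. \<forall>j. f j \<in> gP p}"

definition completion_bracket ::
    "int \<Rightarrow> ('g::comm_monoid_add \<Rightarrow> 'g \<Rightarrow> 'g) \<Rightarrow> (int \<Rightarrow> 'g) \<Rightarrow> (int \<Rightarrow> 'g) \<Rightarrow> int \<Rightarrow> 'g" where
  "completion_bracket h gbr f g k = (\<Sum>i\<in>{- h..k + h}. gbr (f i) (g (k - i)))"

text \<open>\<open>L\<close> is isomorphic to the completion as a filtered Lie superalgebra.\<close>

definition trivial_deformation ::
    "(complex \<Rightarrow> 'a::ab_group_add \<Rightarrow> 'a) \<Rightarrow> (bit \<Rightarrow> 'a set) \<Rightarrow> ('a \<Rightarrow> 'a \<Rightarrow> 'a) \<Rightarrow> int \<Rightarrow> (int \<Rightarrow> 'a set) \<Rightarrow>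
     (complex \<Rightarrow> 'g::ab_group_add \<Rightarrow> 'g) \<Rightarrow> (bit \<Rightarrow> 'g set) \<Rightarrow> ('g \<Rightarrow> 'g \<Rightarrow> 'g) \<Rightarrow> (int \<Rightarrow> 'g set) \<Rightarrow>
     bool" where
  "trivial_deformation scale P br h L gscale gP gbr G \<longleftrightarrow>
     (\<exists>\<Phi> :: 'a \<Rightarrow> int \<Rightarrow> 'g.
        bij_betw \<Phi> UNIV (completion G) \<and>
        (\<forall>x y. \<Phi> (x + y) = (\<lambda>j. \<Phi> x j + \<Phi> y j)) \<and>
        (\<forall>c x. \<Phi> (scale c x) = (\<lambda>j. gscale c (\<Phi> x j))) \<and>
        (\<forall>p. \<Phi> ` P p = completion_parity gP G p) \<and>
        (\<forall>j. \<Phi> ` L j = completion_filt G j) \<and>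
        (\<forall>x y. \<Phi> (br x y) = completion_bracket h gbr (\<Phi> x) (\<Phi> y)))"


section \<open>The superalgebra \<open>\<Lambda>(n,n)\<close> and the Buttin bracket\<close>

text \<open>
  The variables are indexed by a finite linearly ordered type \<open>'n\<close> with \<open>n\<close> elements. A pair
  \<open>(a, I)\<close> stands for the monomial \<open>x^a \<xi>_I\<close>, where \<open>\<xi>_I\<close> is the product of the \<open>\<xi>_i\<close>,
  \<open>i \<in> I\<close>, in increasing order of the indices.
\<close>

type_synonym 'n lam = "(('n \<Rightarrow> nat) \<times> 'n set) \<Rightarrow>\<^sub>0 complex"

abbreviation lam_monom :: "('n \<Rightarrow> nat) \<Rightarrow> 'n set \<Rightarrow> complex \<Rightarrow> 'n lam" where
  "lam_monom a I c \<equiv> Poly_Mapping.single (a, I) c"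

definition lam_scale :: "complex \<Rightarrow> 'n lam \<Rightarrow> 'n lam" where
  "lam_scale c f = Poly_Mapping.map (\<lambda>z. c * z) f"

definition lin_ext :: "(('n \<Rightarrow> nat) \<times> 'n set \<Rightarrow> 'n lam) \<Rightarrow> 'n lam \<Rightarrow> 'n lam" where
  "lin_ext F f = (\<Sum>m\<in>Poly_Mapping.keys f. lam_scale (Poly_Mapping.lookup f m) (F m))"

text \<open>The sign counts the transpositions that sort \<open>\<xi>_I \<xi>_J\<close>.\<close>

definition lam_mult :: "'n::{finite,linorder} lam \<Rightarrow> 'n lam \<Rightarrow> 'n lam" where
  "lam_mult f g = lin_ext (\<lambda>(a, I). lin_ext (\<lambda>(b, J).
     if I \<inter> J = {} then lam_monom (\<lambda>k. a k + b k) (I \<union> J) ((- 1) ^ card {(i, j). i \<in> I \<and> j \<in> J \<and> j < i})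
     else 0) g) f"

definition d_x :: "'n::{finite,linorder} \<Rightarrow> 'n lam \<Rightarrow> 'n lam" where
  "d_x i = lin_ext (\<lambda>(a, I). lam_monom (a(i := a i - 1)) I (of_nat (a i)))"

text \<open>Derivatives in the odd variables are left derivatives.\<close>

definition d_xi :: "'n::{finite,linorder} \<Rightarrow> 'n lam \<Rightarrow> 'n lam" where
  "d_xi i = lin_ext (\<lambda>(a, I). if i \<in> I then lam_monom a (I - {i}) ((- 1) ^ card {j \<in> I. j < i}) else 0)"

text \<open>The linear map \<open>f \<mapsto> (-1)^(p(f)) f\<close>.\<close>

definition parity_sign :: "'n::{finite,linorder} lam \<Rightarrow> 'n lam" where
  "parity_sign = lin_ext (\<lambda>(a, I). lam_monom a I ((- 1) ^ card I))"

definition buttin :: "'n::{finite,linorder} lam \<Rightarrow> 'n lam \<Rightarrow> 'n lam" where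
  "buttin f g = (\<Sum>i\<in>UNIV. lam_mult (d_x i f) (d_xi i g) + lam_mult (d_xi i (parity_sign f)) (d_x i g))"

definition lam_parity :: "bit \<Rightarrow> 'n::{finite,linorder} lam set" where
  "lam_parity p = {f. \<forall>(a, I)\<in>Poly_Mapping.keys f. of_nat (card I) = p}"

definition lam_homogeneous :: "int \<Rightarrow> 'n::{finite,linorder} lam set" where
  "lam_homogeneous d = {f. \<forall>(a, I)\<in>Poly_Mapping.keys f. int ((\<Sum>i\<in>UNIV. a i) + card I) = d}"

definition lam_const :: "complex \<Rightarrow> 'n lam" where
  "lam_const c = lam_monom (\<lambda>_. 0) {} c"

lemma lookup_lam_scale: "Poly_Mapping.lookup (lam_scale c f) m = c * Poly_Mapping.lookup f m"
  by (simp add: lam_scale_def Poly_Mapping.map.rep_eq when_def)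

lemma lam_scale_add_left: "lam_scale (c + d) f = lam_scale c f + lam_scale d f"
  by (rule poly_mapping_eqI) (simp add: lookup_lam_scale lookup_add algebra_simps)

lemma lam_scale_add_right: "lam_scale c (f + g) = lam_scale c f + lam_scale c g"
  by (rule poly_mapping_eqI) (simp add: lookup_lam_scale lookup_add algebra_simps)

lemma lam_scale_zero_left [simp]: "lam_scale 0 f = 0"
  by (rule poly_mapping_eqI) (simp add: lookup_lam_scale)

lemma lam_scale_zero_right [simp]: "lam_scale c 0 = 0"
  by (rule poly_mapping_eqI) (simp add: lookup_lam_scale)

lemma lin_ext_superset:
  assumes "finite S" "Poly_Mapping.keys f \<subseteq> S"
  shows "lin_ext F f = (\<Sum>m\<in>S. lam_scale (Poly_Mapping.lookup f m) (F m))"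
  unfolding lin_ext_def
  by (rule sum.mono_neutral_left) (use assms in \<open>auto simp: in_keys_iff\<close>)

lemma lin_ext_add: "lin_ext F (f + g) = lin_ext F f + lin_ext F g"
proof -
  let ?S = "Poly_Mapping.keys f \<union> Poly_Mapping.keys g"
  have "lin_ext F (f + g) = (\<Sum>m\<in>?S. lam_scale (Poly_Mapping.lookup (f + g) m) (F m))"
    by (rule lin_ext_superset) (auto simp: keys_add)
  also have "\<dots> = (\<Sum>m\<in>?S. lam_scale (Poly_Mapping.lookup f m) (F m))
      + (\<Sum>m\<in>?S. lam_scale (Poly_Mapping.lookup g m) (F m))"
    by (simp add: lookup_add lam_scale_add_left sum.distrib)
  also have "\<dots> = lin_ext F f + lin_ext F g"
    by (simp add: lin_ext_superset[of ?S f] lin_ext_superset[of ?S g])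
  finally show ?thesis .
qed

lemma lin_ext_single: "lin_ext F (Poly_Mapping.single m c) = lam_scale c (F m)"
  by (cases "c = 0") (simp_all add: lin_ext_def)

lemma lin_ext_zero [simp]: "lin_ext F 0 = 0"
  by (simp add: lin_ext_def)

lemma lam_mult_zero [simp]: "lam_mult 0 f = 0" "lam_mult f 0 = 0"
proof -
  show "lam_mult 0 f = 0" by (simp add: lam_mult_def)
  show "lam_mult f 0 = 0"
    by (simp add: lam_mult_def lin_ext_def[of _ f] case_prod_unfold)
qed

lemma d_x_add_const: "d_x i (f + lam_const c) = d_x i f"
  by (simp add: d_x_def lam_const_def lin_ext_add lin_ext_single)

lemma d_xi_add_const: "d_xi i (f + lam_const c) = d_xi i f"
  by (simp add: d_xi_def lam_const_def lin_ext_add lin_ext_single)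

lemma parity_sign_add_const: "parity_sign (f + lam_const c) = parity_sign f + lam_const c"
  by (simp add: parity_sign_def lam_const_def lin_ext_add lin_ext_single lam_scale_def)

lemma buttin_add_const:
  "buttin (f + lam_const c) g = buttin f g" "buttin f (g + lam_const c) = buttin f g"
  by (simp_all add: buttin_def d_x_add_const d_xi_add_const parity_sign_add_const)

lemma lam_const_add: "lam_const (c + d) = lam_const c + lam_const d"
  by (simp add: lam_const_def single_add)

lemma lam_const_zero [simp]: "lam_const 0 = 0"
  by (simp add: lam_const_def)

lemma lam_const_uminus: "lam_const (- c) = - lam_const c"
  by (simp add: lam_const_def single_uminus)

lemma lam_scale_const: "lam_scale c (lam_const d) = lam_const (c * d)"
  by (simp add: lam_const_def lam_scale_def)


section \<open>The Lie superalgebra \<open>HO(n,n) = \<Lambda>(n,n) / C1\<close>\<close>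

quotient_type 'n ho = "'n lam" / "\<lambda>f g. \<exists>c. f = g + lam_const c"
proof (rule equivpI)
  show "reflp (\<lambda>f g :: 'n lam. \<exists>c. f = g + lam_const c)"
    by (rule reflpI, rule exI[of _ 0]) simp
  show "symp (\<lambda>f g :: 'n lam. \<exists>c. f = g + lam_const c)"
    by (rule sympI) (metis add.assoc add.right_neutral add.right_inverse lam_const_uminus)
  show "transp (\<lambda>f g :: 'n lam. \<exists>c. f = g + lam_const c)"
    by (rule transpI) (metis add.assoc lam_const_add)
qed

instantiation ho :: (type) ab_group_add
begin

lift_definition zero_ho :: "'n ho" is 0 .

lift_definition plus_ho :: "'n ho \<Rightarrow> 'n ho \<Rightarrow> 'n ho" is "(+)"
proof -
  fix f f' g g' :: "'n lam"
  assume "\<exists>c. f = f' + lam_const c" "\<exists>c. g = g' + lam_const c"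
  then obtain c d where "f = f' + lam_const c" "g = g' + lam_const d" by blast
  then have "f + g = (f' + g') + lam_const (c + d)" by (simp add: lam_const_add)
  then show "\<exists>c. f + g = (f' + g') + lam_const c" by blast
qed

lift_definition uminus_ho :: "'n ho \<Rightarrow> 'n ho" is uminus
proof -
  fix f f' :: "'n lam"
  assume "\<exists>c. f = f' + lam_const c"
  then obtain c where "f = f' + lam_const c" by blast
  then have "- f = - f' + lam_const (- c)" by (simp add: lam_const_uminus)
  then show "\<exists>c. - f = - f' + lam_const c" by blast
qed

definition minus_ho :: "'n ho \<Rightarrow> 'n ho \<Rightarrow> 'n ho" where
  "minus_ho f g = f + - g"

instance
proof
  fix f g k :: "'n ho"
  show "f + g + k = f + (g + k)"
    by transfer (rule exI[of _ 0], simp add: add.assoc)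
  show "f + g = g + f"
    by transfer (rule exI[of _ 0], simp add: add.commute)
  show "0 + f = f"
    by transfer (rule exI[of _ 0], simp)
  show "- f + f = 0"
    by transfer (rule exI[of _ 0], simp)
  show "f - g = f + - g"
    by (simp add: minus_ho_def)
qed

end

lift_definition ho_scale :: "complex \<Rightarrow> 'n ho \<Rightarrow> 'n ho" is lam_scale
proof -
  fix c and f f' :: "'n lam"
  assume "\<exists>d. f = f' + lam_const d"
  then obtain d where "f = f' + lam_const d" by blast
  then have "lam_scale c f = lam_scale c f' + lam_const (c * d)"
    by (simp add: lam_scale_add_right lam_scale_const)
  then show "\<exists>d. lam_scale c f = lam_scale c f' + lam_const d" by blast
qed

lift_definition ho_bracket ::
    "'n::{finite,linorder} ho \<Rightarrow> 'n ho \<Rightarrow> 'n ho" is buttin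
proof -
  fix f f' g g' :: "'n lam"
  assume "\<exists>c. f = f' + lam_const c" "\<exists>c. g = g' + lam_const c"
  then have "buttin f g = buttin f' g' + lam_const 0"
    by (auto simp: buttin_add_const)
  then show "\<exists>c. buttin f g = buttin f' g' + lam_const c" by blast
qed

text \<open>The parity of \<open>HO(n,n)\<close> is opposite to that of \<open>\<Lambda>(n,n)\<close>.\<close>

definition ho_parity :: "bit \<Rightarrow> 'n::{finite,linorder} ho set" where
  "ho_parity p = abs_ho ` lam_parity (p + 1)"

definition ho_comp :: "int \<Rightarrow> 'n::{finite,linorder} ho set" where
  "ho_comp j = abs_ho ` lam_homogeneous (j + 2)"

end

theory Submission
  imports Defs
begin

text \<open>
  Let \<open>L\<close> be a filtered deformation of \<open>HO(n,n)\<close>, and write \<open>G j\<close> for the component of degree \<open>j\<close> of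
  \<open>HO(n,n)\<close>. In \<open>HO(n,n)\<close> the generators \<open>x_i, \<xi>_i\<close> of \<open>G (-1)\<close> supercommute, because their brackets
  are constants, and they act on polynomials as the partial derivatives \<open>\<partial>/\<partial>\<xi>_i\<close> and
  \<open>- \<partial>/\<partial>x_i\<close>. The proof rests on one observation: if the generators can be lifted to elements
  \<open>D a\<close> of \<open>L\<close> that supercommute exactly, then the deformation is trivial. Indeed one can then
  imitate polynomials inside \<open>L\<close>: an element of \<open>L j\<close> is homogeneous of degree \<open>j\<close> if its
  brackets with the \<open>D a\<close> are homogeneous of degree \<open>j - 1\<close>, where only \<open>0\<close> is homogeneous of degree \<open>-2\<close>. By the
  Jacobi identity the bracket of homogeneous elements is homogeneous of the expected degree
  (\<open>poly_bracket\<close>), so the homogeneous elements are complements to the filtration on which the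
  bracket of \<open>L\<close> is the bracket of \<open>G\<close>, and every element of \<open>L\<close> is the limit of a unique series
  of them. This is the isomorphism with the completion.

  Two cohomological facts are needed, both in the complex of \<open>G (-1)\<close> with values in \<open>G\<close>. That
  each element of \<open>G j\<close> lifts to a homogeneous element (\<open>poly_surj\<close>) uses that closed 1-cochains with
  values in \<open>G k\<close>, \<open>k \<ge> 0\<close>, are exact. That the lifts \<open>D a\<close> can be corrected until they commute
  (\<open>commuting_frame_exists\<close>) uses the same for 2-cochains, since the leading term of the
  brackets of approximately commuting lifts is a closed 2-cochain by the Jacobi identity. Both facts
  are the polynomial Poincare lemma in even and odd variables, with the usual proof by contraction
  with the Euler field (\<open>poincare_one\<close>, \<open>poincare_two\<close>). Passing to the quotient by the
  constants does no harm because all polynomials involved are homogeneous of positive degree.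

  In degree \<open>-1\<close> the second fact fails: there the closed 2-cochains modulo the exact ones are the
  constant 3-forms. This first step uses the element \<open>e = \<Sum> x_i \<xi>_i\<close> of \<open>G 0\<close> instead. It acts on a
  monomial by the number of its odd variables minus its degree in the even variables, so its weights
  are odd on \<open>G (-1)\<close> and even on \<open>G 0\<close>. Lifts \<open>D a\<close> that are eigenvectors of a lift of \<open>e\<close>
  modulo \<open>L 1\<close> exist, and the class of their bracket in \<open>L (-1) / L 0\<close> has even weight, hence vanishes
  (\<open>initial_frame\<close>).

  All but the computations with polynomials is done for an arbitrary graded algebra \<open>G\<close> of depth one
  with these properties.
\<close>

section \<open>Filtered Lie superalgebras\<close>

lemma koszul_commute: "koszul p q = koszul q p"
  and koszul_square [simp]: "koszul p q * koszul p q = 1"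
  and koszul_zero_left [simp]: "koszul 0 q = 1"
  and koszul_add_left: "koszul (p + q) r = koszul p r * koszul q r"
  by (cases p; cases q; cases r; simp add: koszul_def)+

context lie_superalgebra
begin

lemma br_hom_right: "module_hom scale scale (\<lambda>y. br x y)"
  and br_hom_left: "module_hom scale scale (\<lambda>x. br x y)"
  using bracket_linear_right bracket_linear_left by (simp_all add: module_hom_iff_linear)

lemmas br_right = br_hom_right[THEN module_hom.add] br_hom_right[THEN module_hom.diff]
  br_hom_right[THEN module_hom.neg] br_hom_right[THEN module_hom.scale] br_hom_right[THEN module_hom.zero]

lemmas br_left = br_hom_left[THEN module_hom.add] br_hom_left[THEN module_hom.diff]
  br_hom_left[THEN module_hom.neg] br_hom_left[THEN module_hom.scale] br_hom_left[THEN module_hom.zero]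

lemmas br_simps = br_right br_left
lemmas br_sum_right = br_hom_right[THEN module_hom.sum]
lemmas br_sum_left = br_hom_left[THEN module_hom.sum]

lemma parity_split:
  obtains y z where "y \<in> P p" "z \<in> P (p + 1)" "x = y + z"
  using parity_sum[of x] by (cases p) (auto simp: add.commute)

lemma parity_zero: "x \<in> P p \<Longrightarrow> x \<in> P (p + 1) \<Longrightarrow> x = 0"
  using parity_disjoint by (cases p) auto

end

context filtered_lie_superalgebra
begin

lemma filt_antimono: "i \<le> j \<Longrightarrow> L j \<subseteq> L i"
proof (induction j rule: int_ge_induct)
  case (step j)
  then show ?case using filt_decreasing[of j] by blast
qed simp

lemma filt_mono_in: "x \<in> L j \<Longrightarrow> i \<le> j \<Longrightarrow> x \<in> L i"
  using filt_antimono by blast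

lemma filt_bracket_le: "x \<in> L i \<Longrightarrow> y \<in> L j \<Longrightarrow> k \<le> i + j \<Longrightarrow> br x y \<in> L k"
  using filt_bracket filt_mono_in by blast

lemmas filt_add = subspace_add[OF filt_subspace]
lemmas filt_diff = subspace_diff[OF filt_subspace]
lemmas filt_neg = subspace_neg[OF filt_subspace]
lemmas filt_scale = subspace_scale[OF filt_subspace]
lemmas filt_sum = subspace_sum[OF filt_subspace]
lemmas filt_zero = subspace_0[OF filt_subspace]

text \<open>
  The filtration is compatible with the parity decomposition by assumption only for one choice of
  the two components; since the decomposition is unique, every choice has this property.
\<close>

lemma filt_parity_component:
  assumes "y \<in> P p" "z \<in> P (p + 1)" "y + z \<in> L j"
  shows "y \<in> L j" "z \<in> L j"
proof -
  obtain a b where ab: "a \<in> L j" "a \<in> P 0" "b \<in> L j" "b \<in> P 1" "y + z = a + b"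
    using filt_parity[OF assms(3)] by blast
  obtain y' z' where *: "y' \<in> L j" "y' \<in> P p" "z' \<in> L j" "z' \<in> P (p + 1)" "y + z = y' + z'"
    by (cases p) (use ab that[of a b] that[of b a] in \<open>auto simp: add.commute\<close>)
  have eq: "y - y' = z' - z" using *(5) by (simp add: algebra_simps)
  have "y - y' \<in> P p" "z' - z \<in> P (p + 1)"
    using * assms by (auto intro!: subspace_diff[OF parity_subspace] simp only:)
  then have "y - y' = 0" by (rule parity_zero[OF _ ssubst[OF eq]])
  then show "y \<in> L j" "z \<in> L j" using * eq by auto
qed

lemma filt_eq_zero:
  assumes "\<And>k::nat. x \<in> L (int k + c)"
  shows "x = 0"
proof -
  have "x \<in> L j" for j
    using assms[of "nat (j - c)"] by (rule filt_mono_in) auto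
  then show ?thesis using filt_separated by auto
qed

lemma filt_limit:
  assumes step: "\<And>k::nat. X (Suc k) - X k \<in> L (int k + c)"
  obtains x where "\<And>k. x - X k \<in> L (int k + c)"
proof -
  have le: "X m - X k \<in> L (int k + c)" if "k \<le> m" for m k
    using that
  proof (induction m rule: dec_induct)
    case base
    then show ?case by (simp add: filt_zero)
  next
    case (step m)
    have "X (Suc m) - X m \<in> L (int k + c)"
      using assms[of m] by (rule filt_mono_in) (use step in auto)
    from filt_add[OF this step.IH] show ?case by simp
  qed
  \<comment> \<open>The index shift \<open>c\<close> turns this Cauchy property into an explicit rate, which passes to the limit.\<close>
  have "\<forall>j. \<exists>N. \<forall>m\<ge>N. \<forall>k\<ge>N. X m - X k \<in> L j"
  proof
    fix j
    define N where "N = nat (j - c)"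
    have "X m - X k \<in> L j" if "m \<ge> N" "k \<ge> N" for m k
    proof -
      have "X m - X k \<in> L (int N + c)"
        using filt_diff[OF le[OF that(1)] le[OF that(2)]] by simp
      then show ?thesis by (rule filt_mono_in) (auto simp: N_def)
    qed
    then show "\<exists>N. \<forall>m\<ge>N. \<forall>k\<ge>N. X m - X k \<in> L j" by blast
  qed
  then obtain x where x: "\<forall>j. \<exists>N. \<forall>m\<ge>N. X m - x \<in> L j"
    using filt_complete by blast
  have "x - X k \<in> L (int k + c)" for k
  proof -
    obtain N where N: "\<forall>m\<ge>N. X m - x \<in> L (int k + c)" using x by blast
    have "X (max N k) - X k \<in> L (int k + c)" by (rule le) simp
    moreover have "X (max N k) - x \<in> L (int k + c)" using N by simp
    ultimately have "X (max N k) - X k - (X (max N k) - x) \<in> L (int k + c)" by (rule filt_diff)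
    then show ?thesis by simp
  qed
  then show ?thesis by (rule that)
qed

text \<open>
  The component of the wrong parity of the limit is a component of each of the errors, so it lies
  in every step of the filtration.
\<close>

lemma parity_closed:
  assumes X: "\<And>k::nat. X k \<in> P p" and lim: "\<And>k. x - X k \<in> L (int k + c)"
  shows "x \<in> P p"
proof -
  obtain y z where yz: "y \<in> P p" "z \<in> P (p + 1)" "x = y + z" by (rule parity_split)
  have "z \<in> L (int k + c)" for k
  proof (rule filt_parity_component(2))
    show "y - X k \<in> P p" using yz X by (auto intro: subspace_diff[OF parity_subspace])
    show "z \<in> P (p + 1)" by fact
    show "y - X k + z \<in> L (int k + c)" using lim[of k] yz by (simp add: algebra_simps)
  qed
  then have "z = 0" by (rule filt_eq_zero)
  with yz show ?thesis by simp
qed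

end


section \<open>Symbols and acyclic graded algebras\<close>

text \<open>
  The properties of the graded algebra \<open>G\<close> that force the deformations to be trivial. The
  assumptions \<open>transitive\<close>, \<open>closed_exact_1\<close> and \<open>closed_exact_2\<close> are the vanishing in degrees
  \<open>k \<ge> 0\<close> of the cohomology of the span of the \<open>d a\<close> with values in \<open>G\<close>, for cochains of order 0
  and 1 and for even cochains of order 2; a cochain is given by its values on the \<open>d a\<close>. The
  element \<open>e\<close> acts diagonally on the \<open>d a\<close>, with weights \<open>wt a\<close>. The last two assumptions say that
  a sum of two of these weights is no weight of \<open>G (-1)\<close>, and that \<open>e - wt a\<close> is onto on the part
  of \<open>G 0\<close> that has the parity of \<open>d a\<close>.
\<close>

locale acyclic_graded =
  fixes gscale :: "complex \<Rightarrow> 'g::ab_group_add \<Rightarrow> 'g" and gP :: "bit \<Rightarrow> 'g set"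
    and gbr :: "'g \<Rightarrow> 'g \<Rightarrow> 'g" and G :: "int \<Rightarrow> 'g set"
    and d :: "'i::finite \<Rightarrow> 'g" and par :: "'i \<Rightarrow> bit" and e :: 'g and wt :: "'i \<Rightarrow> complex"
  assumes d_in: "d a \<in> G (- 1) \<inter> gP (par a)"
    and d_span: "g \<in> G (- 1) \<Longrightarrow> \<exists>c. g = (\<Sum>a\<in>UNIV. gscale (c a) (d a))"
    and transitive: "k \<ge> 0 \<Longrightarrow> g \<in> G k \<Longrightarrow> (\<And>a. gbr (d a) g = 0) \<Longrightarrow> g = 0"
    and closed_exact_1: "k \<ge> 0 \<Longrightarrow> (\<And>a. \<epsilon> a \<in> G k) \<Longrightarrow>
      (\<And>a b. gbr (d a) (\<epsilon> b) = gscale (koszul (par a) (par b)) (gbr (d b) (\<epsilon> a))) \<Longrightarrow>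
      \<exists>\<nu>\<in>G (k + 1). \<forall>a. gbr (d a) \<nu> = \<epsilon> a"
    and closed_exact_2: "k \<ge> 0 \<Longrightarrow> (\<And>a b. \<gamma> a b \<in> G k \<inter> gP (par a + par b)) \<Longrightarrow>
      (\<And>a b. \<gamma> b a = - gscale (koszul (par a) (par b)) (\<gamma> a b)) \<Longrightarrow>
      (\<And>a b c. gbr (d a) (\<gamma> b c) = gscale (koszul (par a) (par b)) (gbr (d b) (\<gamma> a c))
         - gscale (koszul (par a + par b) (par c)) (gbr (d c) (\<gamma> a b))) \<Longrightarrow>
      \<exists>\<nu>. (\<forall>a. \<nu> a \<in> G (k + 1) \<inter> gP (par a)) \<and>
        (\<forall>a b. \<gamma> a b = gbr (d a) (\<nu> b) - gscale (koszul (par a) (par b)) (gbr (d b) (\<nu> a)))"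
    and e_in: "e \<in> G 0 \<inter> gP 0"
    and e_weight: "gbr e (d a) = gscale (wt a) (d a)"
    and weight_minus_one: "g \<in> G (- 1) \<Longrightarrow> gbr e g = gscale (wt a + wt b) g \<Longrightarrow> g = 0"
    and weight_zero: "g \<in> G 0 \<inter> gP (par a) \<Longrightarrow> \<exists>v\<in>G 0 \<inter> gP (par a). gbr e v - gscale (wt a) v = g"

text \<open>
  The map \<open>\<sigma> j\<close> sends an element of \<open>L j\<close> to its class in \<open>L j / L (j + 1)\<close>, identified with
  \<open>G j\<close>. With it cosets can be avoided: an identity in \<open>G\<close> between symbols is a congruence modulo
  the next step of the filtration.
\<close>

locale symbol_calculus =
  filtered_lie_superalgebra scale P br 1 L + acyclic_graded gscale gP gbr G d par e wt
  for scale :: "complex \<Rightarrow> 'a::ab_group_add \<Rightarrow> 'a" and P :: "bit \<Rightarrow> 'a set"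
    and br :: "'a \<Rightarrow> 'a \<Rightarrow> 'a" and L :: "int \<Rightarrow> 'a set"
    and gscale :: "complex \<Rightarrow> 'g::ab_group_add \<Rightarrow> 'g" and gP :: "bit \<Rightarrow> 'g set"
    and gbr :: "'g \<Rightarrow> 'g \<Rightarrow> 'g" and G :: "int \<Rightarrow> 'g set"
    and d :: "'i::finite \<Rightarrow> 'g" and par :: "'i \<Rightarrow> bit" and e :: 'g and wt :: "'i \<Rightarrow> complex" +
  fixes \<sigma> :: "int \<Rightarrow> 'a \<Rightarrow> 'g"
  assumes sym_add: "u \<in> L j \<Longrightarrow> v \<in> L j \<Longrightarrow> \<sigma> j (u + v) = \<sigma> j u + \<sigma> j v"
    and sym_scale: "u \<in> L j \<Longrightarrow> \<sigma> j (scale c u) = gscale c (\<sigma> j u)"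
    and sym_eq_0_iff: "u \<in> L j \<Longrightarrow> \<sigma> j u = 0 \<longleftrightarrow> u \<in> L (j + 1)"
    and sym_image: "\<sigma> j ` L j = G j"
    and sym_parity: "\<sigma> j ` (L j \<inter> P p) = G j \<inter> gP p"
    and sym_bracket: "u \<in> L i \<Longrightarrow> v \<in> L j \<Longrightarrow> \<sigma> (i + j) (br u v) = gbr (\<sigma> i u) (\<sigma> j v)"
begin

lemma filt_minus_one [simp]: "x \<in> L (- 1)"
  using filt_top[of "-1"] by simp

lemma sym_zero [simp]: "\<sigma> j 0 = 0"
  using sym_eq_0_iff[of 0 j] by (simp add: filt_zero)

lemma sym_neg: "u \<in> L j \<Longrightarrow> \<sigma> j (- u) = - \<sigma> j u"
  using sym_add[of u j "- u"] filt_neg[of u j] minus_unique[of "\<sigma> j u" "\<sigma> j (- u)"] by simp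

lemma sym_diff: "u \<in> L j \<Longrightarrow> v \<in> L j \<Longrightarrow> \<sigma> j (u - v) = \<sigma> j u - \<sigma> j v"
  using sym_add[of u j "- v"] by (simp add: filt_neg sym_neg)

lemma sym_sum: "(\<And>s. s \<in> S \<Longrightarrow> F s \<in> L j) \<Longrightarrow> \<sigma> j (sum F S) = (\<Sum>s\<in>S. \<sigma> j (F s))"
  by (induction S rule: infinite_finite_induct) (auto simp: sym_add filt_sum)

lemma sym_eq_iff: "u \<in> L j \<Longrightarrow> v \<in> L j \<Longrightarrow> \<sigma> j u = \<sigma> j v \<longleftrightarrow> u - v \<in> L (j + 1)"
  using sym_eq_0_iff[of "u - v" j] by (simp add: filt_diff sym_diff)

lemma sym_in: "u \<in> L j \<Longrightarrow> \<sigma> j u \<in> G j"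
  using sym_image by blast

lemma sym_in_parity: "u \<in> L j \<Longrightarrow> u \<in> P p \<Longrightarrow> \<sigma> j u \<in> G j \<inter> gP p"
  using sym_parity by blast

lemma sym_lift: "g \<in> G j \<Longrightarrow> \<exists>u\<in>L j. \<sigma> j u = g"
  by (auto simp: sym_image[symmetric])

lemma sym_lift_parity: "g \<in> G j \<inter> gP p \<Longrightarrow> \<exists>u\<in>L j. u \<in> P p \<and> \<sigma> j u = g"
  by (auto simp: sym_parity[symmetric])

text \<open>
  The depth of the filtration is 1, so \<open>L j = L (j + 1)\<close> for \<open>j < -1\<close>.
\<close>

lemma graded_low: "g \<in> G j \<Longrightarrow> j < - 1 \<Longrightarrow> g = 0"
proof -
  assume "g \<in> G j" "j < - 1"
  then obtain u where "u \<in> L j" "\<sigma> j u = g" using sym_lift by blast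
  moreover have "u \<in> L (j + 1)" using filt_top[of "j + 1"] \<open>j < - 1\<close> by simp
  ultimately show "g = 0" using sym_eq_0_iff[of u j] by simp
qed

end


section \<open>Lifting the generators to commuting elements\<close>

context symbol_calculus
begin

definition frame :: "('i \<Rightarrow> 'a) \<Rightarrow> bool" where
  "frame D \<longleftrightarrow> (\<forall>a. D a \<in> P (par a) \<and> \<sigma> (- 1) (D a) = d a)"

lemma frameD: "frame D \<Longrightarrow> D a \<in> P (par a)" "frame D \<Longrightarrow> \<sigma> (- 1) (D a) = d a"
  by (simp_all add: frame_def)

lemma frame_bracket_filt: "u \<in> L k \<Longrightarrow> br x u \<in> L (k - 1)"
  by (rule filt_bracket_le[of x "-1" u k]) auto

lemma frame_bracket_sym: "frame D \<Longrightarrow> u \<in> L k \<Longrightarrow> \<sigma> (k - 1) (br (D a) u) = gbr (d a) (\<sigma> k u)"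
  using sym_bracket[of "D a" "-1" u k] by (simp add: frameD)

lemma frame_skew: "frame D \<Longrightarrow> u \<in> P p \<Longrightarrow> br u (D a) = - scale (koszul p (par a)) (br (D a) u)"
  using bracket_skew frameD(1) by blast

lemma frame_jacobi: "frame D \<Longrightarrow> u \<in> P p \<Longrightarrow>
    br (D a) (br u v) = br (br (D a) u) v + scale (koszul (par a) p) (br u (br (D a) v))"
  using bracket_jacobi frameD(1) by blast

text \<open>
  Let \<open>E\<close> lift \<open>e\<close>. Since \<open>e - wt a\<close> is onto on \<open>G 0\<close>, a lift \<open>D a\<close> can be corrected within \<open>L 0\<close>
  so that \<open>[E, D a] = wt a \<cdot> D a\<close> modulo \<open>L 1\<close>. Then the class of \<open>[D a, D b]\<close> in \<open>L (-1) / L 0\<close>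
  has weight \<open>wt a + wt b\<close>, and there is no such weight in \<open>G (-1)\<close>.
\<close>

lemma initial_frame: "\<exists>D. frame D \<and> (\<forall>a b. br (D a) (D b) \<in> L 0)"
proof -
  obtain E where E: "E \<in> L 0" "E \<in> P 0" "\<sigma> 0 E = e"
    using sym_lift_parity[OF e_in] by blast
  have brE: "br E u \<in> L k" if "u \<in> L k" for u k
    using filt_bracket[OF E(1) that] by simp
  have symE: "\<sigma> k (br E u) = gbr e (\<sigma> k u)" if "u \<in> L k" for u k
    using sym_bracket[OF E(1) that] E(3) by simp
  have "\<exists>D. D \<in> P (par a) \<and> \<sigma> (- 1) D = d a \<and> br E D - scale (wt a) D \<in> L 1" for a
  proof -
    obtain D where D: "D \<in> P (par a)" "\<sigma> (- 1) D = d a"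
      using sym_lift_parity[OF d_in] by blast
    define r where "r = br E D - scale (wt a) D"
    have "\<sigma> (- 1) r = 0"
      unfolding r_def by (simp add: sym_diff symE sym_scale D e_weight)
    then have r0: "r \<in> L 0" using sym_eq_0_iff[of r "-1"] by simp
    have "br E D \<in> P (par a)" using bracket_parity[OF E(2) D(1)] by (simp only: add_0)
    then have rP: "r \<in> P (par a)"
      unfolding r_def by (intro subspace_diff[OF parity_subspace] subspace_scale[OF parity_subspace] D)
    obtain g where g: "g \<in> G 0 \<inter> gP (par a)" "gbr e g - gscale (wt a) g = \<sigma> 0 r"
      using weight_zero[OF sym_in_parity[OF r0 rP]] by blast
    obtain v where v: "v \<in> L 0" "v \<in> P (par a)" "\<sigma> 0 v = g"
      using sym_lift_parity[OF g(1)] by blast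
    have "\<sigma> 0 (br E v - scale (wt a) v) = \<sigma> 0 r"
      using v g by (simp add: sym_diff symE sym_scale brE filt_scale)
    then have "r - (br E v - scale (wt a) v) \<in> L 1"
      using sym_eq_iff[of r 0 "br E v - scale (wt a) v"] r0 v brE by (simp add: filt_diff filt_scale)
    moreover have "br E (D - v) - scale (wt a) (D - v) = r - (br E v - scale (wt a) v)"
      by (simp add: r_def br_simps scale_right_diff_distrib)
    moreover have "\<sigma> (- 1) (D - v) = d a"
      using D v sym_eq_0_iff[of v "-1"] by (simp add: sym_diff)
    moreover have "D - v \<in> P (par a)"
      using D v by (auto intro: subspace_diff[OF parity_subspace])
    ultimately show ?thesis by metis
  qed
  then obtain D where D: "\<And>a. D a \<in> P (par a)" "\<And>a. \<sigma> (- 1) (D a) = d a"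
      "\<And>a. br E (D a) - scale (wt a) (D a) \<in> L 1"
    by metis
  have "br (D a) (D b) \<in> L 0" for a b
  proof -
    let ?c = "br (D a) (D b)"
    define t where "t a = br E (D a) - scale (wt a) (D a)" for a
    have ED: "br E (D a) = scale (wt a) (D a) + t a" for a by (simp add: t_def)
    have t: "t a \<in> L 1" for a using D by (simp add: t_def)
    have "br E ?c = br (br E (D a)) (D b) + br (D a) (br E (D b))"
      using bracket_jacobi[OF E(2) D(1), of a "D b"] by simp
    also have "\<dots> = scale (wt a + wt b) ?c + (br (t a) (D b) + br (D a) (t b))"
      by (simp add: ED br_simps scale_left_distrib algebra_simps)
    finally have *: "br E ?c - scale (wt a + wt b) ?c = br (t a) (D b) + br (D a) (t b)" by simp
    have "br (t a) (D b) + br (D a) (t b) \<in> L 0"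
      using filt_bracket[of "t a" 1 "D b" "-1"] filt_bracket[of "D a" "-1" "t b" 1] t
      by (auto intro: filt_add)
    then have "\<sigma> (- 1) (br E ?c) = \<sigma> (- 1) (scale (wt a + wt b) ?c)"
      using sym_eq_iff[of "br E ?c" "-1" "scale (wt a + wt b) ?c"] * by simp
    then have "gbr e (\<sigma> (- 1) ?c) = gscale (wt a + wt b) (\<sigma> (- 1) ?c)"
      by (simp add: symE sym_scale)
    then have "\<sigma> (- 1) ?c = 0"
      using weight_minus_one[OF sym_in] by simp
    then show ?thesis using sym_eq_0_iff[of ?c "-1"] by simp
  qed
  with D show ?thesis unfolding frame_def by blast
qed

text \<open>
  The symbols in \<open>G k\<close> of the brackets \<open>[D a, D b]\<close> form a closed 2-cochain, by the Jacobi
  identity. Subtracting from \<open>D\<close> lifts of a primitive of it removes these symbols, and the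
  brackets of the corrections lie even deeper, in \<open>L (2 k + 2)\<close>.
\<close>

lemma improve_frame:
  assumes D: "frame D" and k: "k \<ge> 0" and c: "\<And>a b. br (D a) (D b) \<in> L k"
  shows "\<exists>D'. frame D' \<and> (\<forall>a. D' a - D a \<in> L (k + 1)) \<and> (\<forall>a b. br (D' a) (D' b) \<in> L (k + 1))"
proof -
  let ?s = "\<lambda>a b. koszul (par a) (par b)"
  define \<gamma> where "\<gamma> a b = \<sigma> k (br (D a) (D b))" for a b
  have P: "br (D a) (D b) \<in> P (par a + par b)" for a b
    using bracket_parity frameD(1)[OF D] by blast
  have "\<exists>\<nu>. (\<forall>a. \<nu> a \<in> G (k + 1) \<inter> gP (par a)) \<and>
        (\<forall>a b. \<gamma> a b = gbr (d a) (\<nu> b) - gscale (?s a b) (gbr (d b) (\<nu> a)))"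
  proof (rule closed_exact_2[OF k])
    show "\<gamma> a b \<in> G k \<inter> gP (par a + par b)" for a b
      unfolding \<gamma>_def by (rule sym_in_parity[OF c P])
    show "\<gamma> b a = - gscale (?s a b) (\<gamma> a b)" for a b
      using frame_skew[OF D frameD(1)[OF D], of b a] c[of a b]
      by (simp add: \<gamma>_def sym_neg sym_scale filt_scale koszul_commute)
    show "gbr (d a) (\<gamma> b x) = gscale (?s a b) (gbr (d b) (\<gamma> a x))
         - gscale (koszul (par a + par b) (par x)) (gbr (d x) (\<gamma> a b))" for a b x
    proof -
      have 1: "br (D a) (br (D b) (D x)) = scale (?s a b) (br (D b) (br (D a) (D x)))
          - scale (koszul (par a + par b) (par x)) (br (D x) (br (D a) (D b)))"
        using frame_jacobi[OF D frameD(1)[OF D], of a b "D x"] frame_skew[OF D P, of a b x] by simp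
      have "\<sigma> (k - 1) (br (D a) (br (D b) (D x))) = gscale (?s a b) (\<sigma> (k - 1) (br (D b) (br (D a) (D x))))
          - gscale (koszul (par a + par b) (par x)) (\<sigma> (k - 1) (br (D x) (br (D a) (D b))))"
        unfolding 1 by (simp add: sym_diff sym_scale filt_scale frame_bracket_filt c)
      then show ?thesis by (simp add: \<gamma>_def frame_bracket_sym[OF D c])
    qed
  qed
  then obtain \<nu> where \<nu>: "\<And>a. \<nu> a \<in> G (k + 1) \<inter> gP (par a)"
      "\<And>a b. \<gamma> a b = gbr (d a) (\<nu> b) - gscale (?s a b) (gbr (d b) (\<nu> a))" by blast
  have "\<forall>a. \<exists>v\<in>L (k + 1). v \<in> P (par a) \<and> \<sigma> (k + 1) v = \<nu> a"
    using sym_lift_parity[OF \<nu>(1)] by blast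
  then obtain v where v: "\<And>a. v a \<in> L (k + 1)" "\<And>a. v a \<in> P (par a)" "\<And>a. \<sigma> (k + 1) (v a) = \<nu> a"
    by metis
  \<comment> \<open>Up to terms of \<open>L (k + 1)\<close>, this changes \<open>[D a, D b]\<close> by the coboundary of \<open>v\<close>.\<close>
  define D' where "D' a = D a - v a" for a
  have v0: "v a \<in> L 0" for a
    by (rule filt_mono_in[OF v(1)]) (use k in simp)
  have "frame D'"
    unfolding frame_def D'_def
    using D v sym_eq_0_iff[of "v _" "-1"] v0
    by (auto simp: frameD sym_diff intro!: subspace_diff[OF parity_subspace])
  moreover have "D' a - D a \<in> L (k + 1)" for a
    using filt_neg[OF v(1)] by (simp add: D'_def)
  moreover have "br (D' a) (D' b) \<in> L (k + 1)" for a b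
  proof -
    have Dv: "br (D a) (v b) \<in> L k" for a b
      using frame_bracket_filt[OF v(1)] by simp
    define w where "w = br (D a) (D b) - (br (D a) (v b) - scale (?s a b) (br (D b) (v a)))"
    have symDv: "\<sigma> k (br (D a) (v b)) = gbr (d a) (\<nu> b)" for a b
      using frame_bracket_sym[OF D v(1)] v(3) by simp
    have "\<sigma> k w = 0"
      using \<nu>(2)[of a b] by (simp add: w_def sym_diff sym_scale filt_diff filt_scale c Dv symDv \<gamma>_def)
    moreover have "w \<in> L k" by (simp add: w_def filt_diff filt_scale c Dv)
    ultimately have "w \<in> L (k + 1)" using sym_eq_0_iff by simp
    moreover have "br (v a) (v b) \<in> L (k + 1)"
      by (rule filt_bracket_le[OF v(1) v(1)]) (use k in simp)
    moreover have "br (D' a) (D' b) = w + br (v a) (v b)"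
      using frame_skew[OF D v(2), of a b]
      by (simp add: D'_def br_simps w_def koszul_commute algebra_simps)
    ultimately show ?thesis by (simp add: filt_add)
  qed
  ultimately show ?thesis by blast
qed

text \<open>
  The corrections at step \<open>n\<close> lie in \<open>L (n + 1)\<close>, so the successive frames converge.
\<close>

lemma commuting_frame_exists: "\<exists>D. frame D \<and> (\<forall>a b. br (D a) (D b) = 0)"
proof -
  have "\<exists>X. \<forall>n::nat. (frame (X n) \<and> (\<forall>a b. br (X n a) (X n b) \<in> L (int n))) \<and>
      (\<forall>a. X (Suc n) a - X n a \<in> L (int n + 1))"
  proof (rule dependent_nat_choice)
    show "\<exists>D. frame D \<and> (\<forall>a b. br (D a) (D b) \<in> L (int 0))"
      using initial_frame by simp
    show "\<exists>D'. (frame D' \<and> (\<forall>a b. br (D' a) (D' b) \<in> L (int (Suc n)))) \<and> (\<forall>a. D' a - D a \<in> L (int n + 1))"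
      if "frame D \<and> (\<forall>a b. br (D a) (D b) \<in> L (int n))" for D n
      using improve_frame[of D "int n"] that by (auto simp: add.commute)
  qed
  then obtain X where X: "\<And>n. frame (X n)" "\<And>n a b. br (X n a) (X n b) \<in> L (int n)"
      "\<And>n a. X (Suc n) a - X n a \<in> L (int n + 1)" by blast
  have "\<exists>x. \<forall>n. x - X n a \<in> L (int n + 1)" for a
  proof -
    obtain x where "\<And>n. x - X n a \<in> L (int n + 1)"
      using filt_limit[of "\<lambda>n. X n a" 1, OF X(3)] by blast
    then show ?thesis by blast
  qed
  then obtain D where D: "\<And>a n. D a - X n a \<in> L (int n + 1)" by metis
  have "D a \<in> P (par a)" for a
    by (rule parity_closed[of "\<lambda>n. X n a" _ _ 1]) (auto intro: D frameD X)
  moreover have "\<sigma> (- 1) (D a) = d a" for a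
  proof -
    have "D a - X 0 a \<in> L 0" using D[of a 0] by (auto intro: filt_mono_in)
    then have "\<sigma> (- 1) (D a) = \<sigma> (- 1) (X 0 a)" by (simp add: sym_eq_iff)
    then show ?thesis using frameD(2)[OF X(1)] by simp
  qed
  moreover have "br (D a) (D b) = 0" for a b
  proof (rule filt_eq_zero[of _ 0])
    fix n :: nat
    have "br (D a) (D b) = br (X n a) (X n b) + (br (D a - X n a) (D b) + br (X n a) (D b - X n b))"
      by (simp add: br_simps)
    moreover have "br (D a - X n a) (D b) \<in> L (int n)"
      by (rule filt_bracket_le[OF D, of _ "-1"]) auto
    moreover have "br (X n a) (D b - X n b) \<in> L (int n)"
      using frame_bracket_filt[OF D] by simp
    ultimately show "br (D a) (D b) \<in> L (int n + 0)"
      using X(2) by (simp add: filt_add)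
  qed
  ultimately show ?thesis unfolding frame_def by blast
qed

end


section \<open>Homogeneous elements with respect to commuting lifts\<close>

locale commuting_frame =
  symbol_calculus scale P br L gscale gP gbr G d par e wt \<sigma>
  for scale :: "complex \<Rightarrow> 'a::ab_group_add \<Rightarrow> 'a" and P :: "bit \<Rightarrow> 'a set"
    and br :: "'a \<Rightarrow> 'a \<Rightarrow> 'a" and L :: "int \<Rightarrow> 'a set"
    and gscale :: "complex \<Rightarrow> 'g::ab_group_add \<Rightarrow> 'g" and gP :: "bit \<Rightarrow> 'g set"
    and gbr :: "'g \<Rightarrow> 'g \<Rightarrow> 'g" and G :: "int \<Rightarrow> 'g set"
    and d :: "'i::finite \<Rightarrow> 'g" and par :: "'i \<Rightarrow> bit" and e :: 'g and wt :: "'i \<Rightarrow> complex"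
    and \<sigma> :: "int \<Rightarrow> 'a \<Rightarrow> 'g" +
  fixes D :: "'i \<Rightarrow> 'a"
  assumes frame_D: "frame D" and commute: "br (D a) (D b) = 0"
begin

lemmas D_parity = frameD(1)[OF frame_D]
lemmas D_sym = frameD(2)[OF frame_D]
lemmas D_bracket_sym = frame_bracket_sym[OF frame_D]
lemmas D_jacobi = frame_jacobi[OF frame_D]

lemma D_swap: "br (D a) (br (D b) u) = scale (koszul (par a) (par b)) (br (D b) (br (D a) u))"
  using D_jacobi[OF D_parity, of a b u] by (simp add: commute br_simps)

text \<open>
  An element of \<open>L k\<close> that commutes with all \<open>D a\<close> has a symbol that commutes with all \<open>d a\<close>, so
  it lies in \<open>L (k + 1)\<close>.
\<close>

lemma D_transitive:
  assumes u: "u \<in> L 0" and D: "\<And>a. br (D a) u = 0"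
  shows "u = 0"
proof (rule filt_eq_zero[of _ 0])
  show "u \<in> L (int k + 0)" for k
  proof (induction k)
    case (Suc k)
    then have uk: "u \<in> L (int k)" by simp
    have "gbr (d a) (\<sigma> (int k) u) = 0" for a
      using D_bracket_sym[OF uk, of a] by (simp add: D)
    then have "\<sigma> (int k) u = 0"
      using transitive[OF _ sym_in[OF uk]] by simp
    then show ?case using sym_eq_0_iff[OF uk] by (simp add: add.commute)
  qed (use u in simp)
qed

text \<open>
  The exactness of closed 1-cochains passes from \<open>G\<close> to \<open>L\<close>: a primitive of the symbols, lifted to
  \<open>L\<close>, is a primitive up to an error one step deeper, which is again closed because the \<open>D a\<close>
  commute exactly. The sum of these approximations converges.
\<close>

lemma D_integrate:
  assumes m: "m \<ge> 0" and \<epsilon>: "\<And>a. \<epsilon> a \<in> L m"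
    and closed: "\<And>a b. br (D a) (\<epsilon> b) = scale (koszul (par a) (par b)) (br (D b) (\<epsilon> a))"
  shows "\<exists>v\<in>L (m + 1). \<forall>a. br (D a) v = \<epsilon> a"
proof -
  have "\<exists>V. \<forall>n::nat. (V n \<in> L (m + 1) \<and> (\<forall>a. \<epsilon> a - br (D a) (V n) \<in> L (m + int n))) \<and>
      V (Suc n) - V n \<in> L (int n + (m + 1))"
  proof (rule dependent_nat_choice)
    show "\<exists>v. v \<in> L (m + 1) \<and> (\<forall>a. \<epsilon> a - br (D a) v \<in> L (m + int 0))"
      using \<epsilon> by (intro exI[of _ 0]) (simp add: filt_zero br_simps)
    show "\<exists>v'. (v' \<in> L (m + 1) \<and> (\<forall>a. \<epsilon> a - br (D a) v' \<in> L (m + int (Suc n)))) \<and> v' - v \<in> L (int n + (m + 1))"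
      if v: "v \<in> L (m + 1) \<and> (\<forall>a. \<epsilon> a - br (D a) v \<in> L (m + int n))" for v n
    proof -
      define r where "r a = \<epsilon> a - br (D a) v" for a
      define k where "k = m + int n"
      have k: "k \<ge> 0" using m by (simp add: k_def)
      have r: "r a \<in> L k" for a using v by (simp add: r_def k_def)
      have closed_r: "br (D a) (r b) = scale (koszul (par a) (par b)) (br (D b) (r a))" for a b
        using closed[of a b] D_swap[of a b v] by (simp add: r_def br_simps scale_right_diff_distrib)
      have "\<exists>\<nu>\<in>G (k + 1). \<forall>a. gbr (d a) \<nu> = \<sigma> k (r a)"
      proof (rule closed_exact_1[OF k])
        show "\<sigma> k (r a) \<in> G k" for a by (rule sym_in[OF r])
        show "gbr (d a) (\<sigma> k (r b)) = gscale (koszul (par a) (par b)) (gbr (d b) (\<sigma> k (r a)))" for a b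
          using arg_cong[OF closed_r[of a b], of "\<sigma> (k - 1)"]
          by (simp add: D_bracket_sym[OF r] sym_scale frame_bracket_filt[OF r])
      qed
      then obtain \<nu> where \<nu>: "\<nu> \<in> G (k + 1)" "\<And>a. gbr (d a) \<nu> = \<sigma> k (r a)" by blast
      obtain w where w: "w \<in> L (k + 1)" "\<sigma> (k + 1) w = \<nu>" using sym_lift[OF \<nu>(1)] by blast
      have "r a - br (D a) w \<in> L (k + 1)" for a
      proof -
        have "\<sigma> k (r a) = \<sigma> k (br (D a) w)"
          using D_bracket_sym[OF w(1), of a] \<nu>(2) w(2) by simp
        then show ?thesis
          using sym_eq_iff[OF r, of "br (D a) w" a] frame_bracket_filt[OF w(1), of "D a"] by simp
      qed
      moreover have "r a - br (D a) w = \<epsilon> a - br (D a) (v + w)" for a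
        by (simp add: r_def br_simps algebra_simps)
      moreover have "w \<in> L (m + 1)"
        by (rule filt_mono_in[OF w(1)]) (simp add: k_def)
      ultimately show ?thesis
        using v w(1) by (intro exI[of _ "v + w"]) (simp add: filt_add k_def algebra_simps)
    qed
  qed
  then obtain V where V: "\<And>n. V n \<in> L (m + 1)" "\<And>n a. \<epsilon> a - br (D a) (V n) \<in> L (m + int n)"
      "\<And>n. V (Suc n) - V n \<in> L (int n + (m + 1))" by blast
  obtain v where v: "\<And>n. v - V n \<in> L (int n + (m + 1))"
    using filt_limit[of V "m + 1", OF V(3)] by blast
  have "v - V 0 + V 0 \<in> L (m + 1)"
    by (rule filt_add) (use v[of 0] V(1) in auto)
  then have "v \<in> L (m + 1)" by simp
  moreover have "br (D a) v = \<epsilon> a" for a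
  proof -
    have "\<epsilon> a - br (D a) v = 0"
    proof (rule filt_eq_zero[of _ m])
      fix n :: nat
      have "br (D a) (v - V n) \<in> L (m + int n)"
        using frame_bracket_filt[OF v, of "D a" n] by (simp add: add.commute)
      then have "\<epsilon> a - br (D a) (V n) - br (D a) (v - V n) \<in> L (m + int n)"
        by (rule filt_diff[OF V(2)])
      then show "\<epsilon> a - br (D a) v \<in> L (int n + m)"
        by (simp add: br_simps add.commute)
    qed
    then show ?thesis by simp
  qed
  ultimately show ?thesis by blast
qed

text \<open>
  \<open>poly m\<close> is the analogue in \<open>L\<close> of the homogeneous polynomials of total degree \<open>m\<close>, modulo
  constants: all its brackets with the \<open>D a\<close> have degree \<open>m - 1\<close>. Polynomials of degree \<open>m\<close> have
  degree \<open>m - 2\<close> in the gradation, which explains the filtration index for \<open>Suc m\<close>. The constants,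
  of degree 0, are zero in the quotient.
\<close>

primrec poly :: "nat \<Rightarrow> 'a set" where
  "poly 0 = {0}"
| "poly (Suc m) = {u \<in> L (int m - 1). \<forall>a. br (D a) u \<in> poly m}"

lemma poly_subspace: "subspace (poly m)"
proof (induction m)
  case (Suc m)
  then show ?case
    using filt_subspace[of "int m - 1"] by (simp add: subspace_def br_simps)
qed simp

lemma poly_parity_component:
  assumes "y \<in> P p" "z \<in> P (p + 1)" "y + z \<in> poly m"
  shows "y \<in> poly m" "z \<in> poly m"
  using assms
proof (induction m arbitrary: y z p)
  case 0
  {
    case 1
    then have "y = - z" by (simp add: eq_neg_iff_add_eq_0)
    then have "y \<in> P (p + 1)" using 1 subspace_neg[OF parity_subspace] by blast
    then show ?case using parity_zero 1 by auto
  next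
    case 2
    then have "z = - y" by (simp add: eq_neg_iff_add_eq_0 add.commute)
    then have "z \<in> P p" using 2 subspace_neg[OF parity_subspace] by blast
    then show ?case using parity_zero 2 by auto
  }
next
  case (Suc m)
  have *: "br (D a) y \<in> P (par a + p)" "br (D a) z \<in> P (par a + p + 1)" "br (D a) y + br (D a) z \<in> poly m"
    if "y \<in> P p" "z \<in> P (p + 1)" "y + z \<in> poly (Suc m)" for a y z p
    using that bracket_parity[OF D_parity that(1), of a] bracket_parity[OF D_parity that(2), of a]
    by (simp_all add: br_simps add.assoc)
  {
    case 1
    then show ?case using Suc.IH(1)[OF *[OF 1]] filt_parity_component(1)[of y p z] by auto
  next
    case 2
    then show ?case using Suc.IH(2)[OF *[OF 2]] filt_parity_component(2)[of y p z] by auto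
  }
qed

text \<open>
  Bracketing with the \<open>D a\<close> lowers both indices by one, until the element commutes with all of
  them.
\<close>

lemma poly_inj: "u \<in> poly (Suc m) \<Longrightarrow> u \<in> L (int m) \<Longrightarrow> u = 0"
proof (induction m arbitrary: u)
  case 0
  then have "br (D a) u = 0" for a by simp
  moreover have "u \<in> L 0" using 0 by simp
  ultimately show ?case by (rule D_transitive[rotated])
next
  case (Suc m)
  have "br (D a) u = 0" for a
    using Suc.prems frame_bracket_filt[of u "int (Suc m)" "D a"] by (intro Suc.IH) auto
  moreover have "u \<in> L 0" using Suc.prems(2) by (rule filt_mono_in) simp
  ultimately show ?case by (rule D_transitive[rotated])
qed

lemma D_combination_poly: "(\<Sum>a\<in>UNIV. scale (c a) (D a)) \<in> poly (Suc 0)"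
  by (intro subspace_sum[OF poly_subspace] subspace_scale[OF poly_subspace]) (simp add: commute)

lemma D_combination_sym: "g \<in> G (- 1) \<Longrightarrow> \<exists>c. \<sigma> (- 1) (\<Sum>a\<in>UNIV. scale (c a) (D a)) = g"
  using d_span[of g] by (auto simp: sym_sum sym_scale D_sym)

text \<open>
  The linear polynomials are the combinations of the \<open>D a\<close>. This is the start of the induction for
  brackets, because the \<open>D a\<close> commute.
\<close>

lemma poly_one: "u \<in> poly (Suc 0) \<Longrightarrow> \<exists>c. u = (\<Sum>a\<in>UNIV. scale (c a) (D a))"
proof -
  assume u: "u \<in> poly (Suc 0)"
  obtain c where c: "\<sigma> (- 1) (\<Sum>a\<in>UNIV. scale (c a) (D a)) = \<sigma> (- 1) u"
    using D_combination_sym[OF sym_in[of u]] by auto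
  then have "u - (\<Sum>a\<in>UNIV. scale (c a) (D a)) \<in> L 0"
    using sym_eq_iff[of u "-1" "\<Sum>a\<in>UNIV. scale (c a) (D a)"] by simp
  then have "u - (\<Sum>a\<in>UNIV. scale (c a) (D a)) = 0"
    using poly_inj[OF subspace_diff[OF poly_subspace u D_combination_poly]] by simp
  then show ?thesis by auto
qed

text \<open>
  Given \<open>g\<close>, the required brackets of its lift with the \<open>D a\<close> are known by induction: they are the
  homogeneous lifts \<open>w a\<close> of \<open>[d a, g]\<close>. An arbitrary lift \<open>u0\<close> of \<open>g\<close> realises them up to errors
  \<open>\<epsilon> a\<close> in \<open>L m\<close>. If the errors are closed, then integrating them gives the correction of \<open>u0\<close>.
\<close>

lemma poly_surj: "g \<in> G (int m - 1) \<Longrightarrow> \<exists>u\<in>poly (Suc m). \<sigma> (int m - 1) u = g"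
proof (induction m arbitrary: g)
  case 0
  then obtain c where "\<sigma> (- 1) (\<Sum>a\<in>UNIV. scale (c a) (D a)) = g"
    using D_combination_sym[of g] by auto
  then show ?case
    using D_combination_poly[of c] by (intro bexI[of _ "\<Sum>a\<in>UNIV. scale (c a) (D a)"]) auto
next
  case (Suc m)
  obtain u0 where u0: "u0 \<in> L (int m)" "\<sigma> (int m) u0 = g"
    using sym_lift[OF Suc.prems] by auto
  have Du0: "br (D a) u0 \<in> L (int m - 1)" for a by (rule frame_bracket_filt[OF u0(1)])
  have "\<forall>a. \<exists>w\<in>poly (Suc m). \<sigma> (int m - 1) w = \<sigma> (int m - 1) (br (D a) u0)"
    using Suc.IH sym_in[OF Du0] by blast
  then obtain w where w: "\<And>a. w a \<in> poly (Suc m)"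
      "\<And>a. \<sigma> (int m - 1) (w a) = \<sigma> (int m - 1) (br (D a) u0)"
    by metis
  have wL: "w a \<in> L (int m - 1)" for a using w(1)[of a] by simp
  define \<epsilon> where "\<epsilon> a = w a - br (D a) u0" for a
  have \<epsilon>L: "\<epsilon> a \<in> L (int m)" for a
    using sym_eq_iff[OF wL Du0, of a a] w(2) by (simp add: \<epsilon>_def)
  have closed: "br (D a) (\<epsilon> b) = scale (koszul (par a) (par b)) (br (D b) (\<epsilon> a))" for a b
  proof -
    define t where "t = br (D a) (w b) - scale (koszul (par a) (par b)) (br (D b) (w a))"
    \<comment> \<open>The first form of \<open>t\<close> shows that it is homogeneous, the second that it lies one step deeper than
      its degree allows.\<close>
    have t_eq: "t = br (D a) (\<epsilon> b) - scale (koszul (par a) (par b)) (br (D b) (\<epsilon> a))"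
      using D_swap[of a b u0] by (simp add: t_def \<epsilon>_def br_simps scale_right_diff_distrib)
    have "t \<in> poly m"
      unfolding t_def using w(1)
      by (intro subspace_diff[OF poly_subspace] subspace_scale[OF poly_subspace]) auto
    moreover have "t \<in> L (int m - 1)"
      unfolding t_eq by (intro filt_diff filt_scale frame_bracket_filt \<epsilon>L)
    ultimately have "t = 0"
      using poly_inj[of t "m - 1"] by (cases m) auto
    then show ?thesis by (simp add: t_eq)
  qed
  obtain v where v: "v \<in> L (int m + 1)" "\<And>a. br (D a) v = \<epsilon> a"
    using D_integrate[OF of_nat_0_le_iff \<epsilon>L closed] by blast
  have vm: "v \<in> L (int m)" by (rule filt_mono_in[OF v(1)]) simp
  have "br (D a) (u0 + v) = w a" for a
    using v(2)[of a] by (simp add: br_simps \<epsilon>_def)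
  then have "u0 + v \<in> poly (Suc (Suc m))"
    using u0(1) vm w(1) filt_add by simp
  moreover have "\<sigma> (int m) (u0 + v) = g"
    using u0 vm v(1) sym_eq_0_iff[OF vm] by (simp add: sym_add)
  ultimately show ?case by auto
qed

text \<open>
  The bracket with \<open>D a\<close> is a derivation, so it lowers the degree of one of the two factors by
  one; induction on the sum of the degrees.
\<close>

lemma poly_bracket:
  "u \<in> poly (Suc m) \<Longrightarrow> v \<in> poly (Suc n) \<Longrightarrow> m + n = k \<Longrightarrow> br u v \<in> poly k"
proof (induction k arbitrary: m n u v)
  case 0
  then obtain c c' where "u = (\<Sum>a\<in>UNIV. scale (c a) (D a))" "v = (\<Sum>a\<in>UNIV. scale (c' a) (D a))"
    using poly_one by (metis add_is_0)
  then show ?case by (simp add: br_sum_right br_sum_left br_simps commute)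
next
  case (Suc k)
  have hom: "br y v \<in> poly (Suc k)" if y: "y \<in> P p" "y \<in> poly (Suc m)" for y p
  proof -
    have "br (D a) (br y v) \<in> poly k" for a
    proof -
      have "br (br (D a) y) v \<in> poly k"
      proof (cases m)
        case 0
        then show ?thesis using y(2) subspace_0[OF poly_subspace] by (simp add: br_simps)
      next
        case (Suc m')
        then show ?thesis using y(2) Suc.prems by (intro Suc.IH[of _ m' v n]) auto
      qed
      moreover have "br y (br (D a) v) \<in> poly k"
      proof (cases n)
        case 0
        then show ?thesis using Suc.prems(2) subspace_0[OF poly_subspace] by (simp add: br_simps)
      next
        case (Suc n')
        then show ?thesis using y(2) Suc.prems by (intro Suc.IH[of _ m _ n']) auto
      qed
      ultimately show ?thesis
        unfolding D_jacobi[OF y(1)]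
        by (intro subspace_add[OF poly_subspace] subspace_scale[OF poly_subspace])
    qed
    moreover have "br y v \<in> L (int k - 1)"
      by (rule filt_bracket_le[of _ "int m - 1" _ "int n - 1"]) (use y Suc.prems in auto)
    ultimately show ?thesis by simp
  qed
  obtain y z where yz: "y \<in> P 0" "z \<in> P (0 + 1)" "u = y + z" by (rule parity_split)
  then have "y \<in> poly (Suc m)" "z \<in> poly (Suc m)"
    using poly_parity_component[of y 0 z "Suc m"] Suc.prems by auto
  with yz show ?case
    unfolding yz(3) br_left by (intro subspace_add[OF poly_subspace] hom)
qed

text \<open>
  The homogeneous elements by degree in the gradation. Truncation to \<open>nat\<close> gives \<open>{0}\<close> in all
  degrees below \<open>-1\<close>.
\<close>

definition homog :: "int \<Rightarrow> 'a set" where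
  "homog j = poly (nat (j + 2))"

lemma homog_subspace: "subspace (homog j)"
  by (simp add: homog_def poly_subspace)

lemma homog_low: "j < - 1 \<Longrightarrow> homog j = {0}"
  by (simp add: homog_def)

lemma homog_index: "j \<ge> - 1 \<Longrightarrow> \<exists>m. j = int m - 1 \<and> homog j = poly (Suc m)"
proof -
  assume j: "j \<ge> - 1"
  then have "nat (j + 2) = Suc (nat (j + 1))" by linarith
  then show ?thesis
    using j by (intro exI[of _ "nat (j + 1)"]) (simp add: homog_def del: poly.simps)
qed

lemma homog_cases [consumes 1, case_names low poly]:
  assumes "u \<in> homog j"
    and "j < - 1 \<Longrightarrow> u = 0 \<Longrightarrow> thesis"
    and "\<And>m. j = int m - 1 \<Longrightarrow> u \<in> poly (Suc m) \<Longrightarrow> thesis"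
  shows thesis
  using assms homog_low[of j] homog_index[of j] by (cases "j < - 1") auto

lemma homog_filt: "u \<in> homog j \<Longrightarrow> u \<in> L j"
  by (cases rule: homog_cases, assumption) (simp_all add: filt_zero)

lemma homog_inj:
  assumes "u \<in> homog j" "u \<in> L (j + 1)"
  shows "u = 0"
  using assms(1)
proof (cases rule: homog_cases)
  case (poly m)
  with assms(2) show ?thesis by (intro poly_inj[of u m]) simp_all
qed

lemma homog_surj:
  assumes g: "g \<in> G j"
  shows "\<exists>u\<in>homog j. \<sigma> j u = g"
proof (cases "j < - 1")
  case True
  then show ?thesis using graded_low[OF g] by (simp add: homog_low)
next
  case False
  then obtain m where "j = int m - 1" "homog j = poly (Suc m)" using homog_index[of j] by auto
  then show ?thesis using poly_surj[of g m] g by simp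
qed

lemma homog_br: "u \<in> homog i \<Longrightarrow> v \<in> homog j \<Longrightarrow> br u v \<in> homog (i + j)"
proof (cases "i < - 1 \<or> j < - 1")
  case True
  assume "u \<in> homog i" "v \<in> homog j"
  with True show ?thesis using homog_low subspace_0[OF homog_subspace] by (auto simp: br_simps)
next
  case False
  assume *: "u \<in> homog i" "v \<in> homog j"
  obtain m n where "i = int m - 1" "homog i = poly (Suc m)" "j = int n - 1" "homog j = poly (Suc n)"
    using False homog_index[of i] homog_index[of j] by auto
  moreover from this have "homog (i + j) = poly (m + n)" by (simp add: homog_def nat_add_distrib)
  ultimately show ?thesis using poly_bracket[of u m v n] * by simp
qed

text \<open>
  The component of the wrong parity is homogeneous as well, and its symbol vanishes.
\<close>

lemma homog_parity:
  assumes "u \<in> homog j" "\<sigma> j u \<in> gP p"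
  shows "u \<in> P p"
proof -
  obtain u' where u': "u' \<in> L j" "u' \<in> P p" "\<sigma> j u' = \<sigma> j u"
    using sym_lift_parity[of "\<sigma> j u" j p] sym_in[OF homog_filt[OF assms(1)]] assms(2) by auto
  obtain y z where yz: "y \<in> P p" "z \<in> P (p + 1)" "u = y + z" by (rule parity_split)
  have "y - u' + z \<in> L (j + 1)"
    using sym_eq_iff[OF homog_filt[OF assms(1)] u'(1)] u'(3) yz(3) by (simp add: algebra_simps)
  then have "z \<in> L (j + 1)"
    by (rule filt_parity_component(2)[OF subspace_diff[OF parity_subspace yz(1) u'(2)] yz(2)])
  moreover have "z \<in> homog j"
    using poly_parity_component(2)[OF yz(1,2)] assms(1) yz(3) by (simp add: homog_def)
  ultimately have "z = 0" by (intro homog_inj)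
  with yz show ?thesis by simp
qed

end


section \<open>Expansion in homogeneous elements\<close>

text \<open>
  Course-of-values induction on degrees. It has a base case because everything of degree below
  \<open>-1\<close> is zero.
\<close>

lemma degree_induct [case_names low step]:
  assumes "\<And>i. i < - 1 \<Longrightarrow> Q i" "\<And>i::int. - 1 \<le> i \<Longrightarrow> (\<And>l. l < i \<Longrightarrow> Q l) \<Longrightarrow> Q i"
  shows "Q i"
proof (induction "nat (i + 2)" arbitrary: i rule: less_induct)
  case less
  show ?case
  proof (cases "i < - 1")
    case False
    show ?thesis
    proof (rule assms(2))
      show "Q l" if "l < i" for l by (rule less) (use that False in simp)
    qed (use False in simp)
  qed (rule assms(1))
qed

context commuting_frame
begin

definition rep :: "int \<Rightarrow> 'g \<Rightarrow> 'a" where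
  "rep j g = (SOME u. u \<in> homog j \<and> \<sigma> j u = g)"

lemma rep:
  assumes "g \<in> G j"
  shows rep_in_W: "rep j g \<in> homog j" and sym_rep: "\<sigma> j (rep j g) = g"
  using someI_ex[of "\<lambda>u. u \<in> homog j \<and> \<sigma> j u = g"] homog_surj[OF assms] unfolding rep_def by blast+

lemma rep_filt: "g \<in> G j \<Longrightarrow> rep j g \<in> L j"
  by (rule homog_filt[OF rep_in_W])

lemma rep_sym:
  assumes u: "u \<in> homog j"
  shows "rep j (\<sigma> j u) = u"
proof -
  note g = sym_in[OF homog_filt[OF u]]
  have "rep j (\<sigma> j u) - u \<in> L (j + 1)"
    using sym_eq_iff[OF rep_filt[OF g] homog_filt[OF u]] sym_rep[OF g] by simp
  then have "rep j (\<sigma> j u) - u = 0"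
    by (rule homog_inj[OF subspace_diff[OF homog_subspace rep_in_W[OF g] u]])
  then show ?thesis by simp
qed

lemma graded_add: "g \<in> G j \<Longrightarrow> g' \<in> G j \<Longrightarrow> g + g' \<in> G j"
  using sym_in[of "rep j g + rep j g'" j] by (simp add: sym_add rep_filt sym_rep filt_add)

lemma graded_scale: "g \<in> G j \<Longrightarrow> gscale c g \<in> G j"
  using sym_in[of "scale c (rep j g)" j] by (simp add: sym_scale rep_filt sym_rep filt_scale)

lemma graded_zero: "0 \<in> G j"
  using sym_in[of 0 j] by (simp add: filt_zero)

lemma rep_add: "g \<in> G j \<Longrightarrow> g' \<in> G j \<Longrightarrow> rep j (g + g') = rep j g + rep j g'"
  using rep_sym[of "rep j g + rep j g'" j]
  by (simp add: sym_add rep_filt sym_rep subspace_add[OF homog_subspace] rep_in_W)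

lemma rep_scale: "g \<in> G j \<Longrightarrow> rep j (gscale c g) = scale c (rep j g)"
  using rep_sym[of "scale c (rep j g)" j]
  by (simp add: sym_scale rep_filt sym_rep subspace_scale[OF homog_subspace] rep_in_W)

lemma rep_zero [simp]: "rep j 0 = 0"
  using rep_sym[OF subspace_0[OF homog_subspace], of j] by simp

lemma rep_parity: "g \<in> G j \<Longrightarrow> g \<in> gP p \<Longrightarrow> rep j g \<in> P p"
  by (rule homog_parity[OF rep_in_W]) (simp_all add: sym_rep)

definition partial :: "(int \<Rightarrow> 'g) \<Rightarrow> int \<Rightarrow> 'a" where
  "partial f N = (\<Sum>i\<in>{- 1..<N}. rep i (f i))"

definition expands :: "'a \<Rightarrow> (int \<Rightarrow> 'g) \<Rightarrow> bool" where
  "expands u f \<longleftrightarrow> f \<in> completion G \<and> (\<forall>N\<ge>- 1. u - partial f N \<in> L N)"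

lemma completionD: "f \<in> completion G \<Longrightarrow> f j \<in> G j"
  by (simp add: completion_def)

lemma partial_minus_one [simp]: "partial f (- 1) = 0"
  by (simp add: partial_def)

lemma partial_step: "N \<ge> - 1 \<Longrightarrow> partial f (N + 1) = partial f N + rep N (f N)"
proof -
  assume "N \<ge> - 1"
  then have "{- 1..<N + 1} = insert N {- 1..<N}" by auto
  then show ?thesis by (simp add: partial_def add.commute)
qed

lemma partial_cong: "(\<And>i. i < N \<Longrightarrow> f i = f' i) \<Longrightarrow> partial f N = partial f' N"
  unfolding partial_def by (rule sum.cong) auto

lemma partial_parity: "f \<in> completion G \<Longrightarrow> (\<And>i. i < N \<Longrightarrow> f i \<in> gP p) \<Longrightarrow> partial f N \<in> P p"
  unfolding partial_def
  by (rule subspace_sum[OF parity_subspace]) (auto intro: rep_parity completionD)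

lemma partial_vanish: "(\<And>i. i < N \<Longrightarrow> f i = 0) \<Longrightarrow> partial f N = 0"
  unfolding partial_def by (rule sum.neutral) auto

lemma expands_component:
  assumes "expands u f" "j \<ge> - 1"
  shows "f j = \<sigma> j (u - partial f j)"
proof -
  have f: "f j \<in> G j" and *: "u - partial f j \<in> L j" "u - partial f (j + 1) \<in> L (j + 1)"
    using assms by (auto simp: expands_def completionD)
  from * have "(u - partial f j) - rep j (f j) \<in> L (j + 1)"
    by (simp add: partial_step[OF assms(2)] diff_diff_eq)
  then show ?thesis
    using sym_eq_iff[OF *(1) rep_filt[OF f]] sym_rep[OF f] by simp
qed

lemma expands_unique_right:
  assumes u: "expands u f" "expands u f'"
  shows "f = f'"
proof
  have f: "f \<in> completion G" "f' \<in> completion G" using u by (simp_all add: expands_def)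
  fix j
  show "f j = f' j"
  proof (induction j rule: degree_induct)
    case (low i)
    then show ?case
      using graded_low[OF completionD[OF f(1)]] graded_low[OF completionD[OF f(2)]] by simp
  next
    case (step i)
    have "partial f i = partial f' i" by (rule partial_cong) (rule step)
    then show ?case
      using expands_component[OF u(1) step(1)] expands_component[OF u(2) step(1)] by simp
  qed
qed

lemma expands_unique_left:
  assumes "expands u f" "expands u' f"
  shows "u = u'"
proof -
  have "u - u' = 0"
  proof (rule filt_eq_zero[of _ "-1"])
    fix k :: nat
    have "u - partial f (int k - 1) - (u' - partial f (int k - 1)) \<in> L (int k - 1)"
      by (rule filt_diff) (use assms in \<open>auto simp: expands_def\<close>)
    then show "u - u' \<in> L (int k + - 1)" by simp
  qed
  then show ?thesis by simp
qed

text \<open>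
  The components are found one after another: \<open>R k\<close> is what remains of \<open>u\<close> after the terms of
  degree below \<open>k - 1\<close> are subtracted, and its symbol is the next component.
\<close>

lemma expands_exists: "\<exists>f. expands u f"
proof -
  define R where "R = rec_nat u (\<lambda>k v. v - rep (int k - 1) (\<sigma> (int k - 1) v))"
  have R0: "R 0 = u" and RS: "R (Suc k) = R k - rep (int k - 1) (\<sigma> (int k - 1) (R k))" for k
    by (simp_all add: R_def)
  have RL: "R k \<in> L (int k - 1)" for k
  proof (induction k)
    case (Suc k)
    note g = sym_in[OF Suc]
    have "R k - rep (int k - 1) (\<sigma> (int k - 1) (R k)) \<in> L (int k - 1 + 1)"
      using sym_eq_iff[OF Suc rep_filt[OF g]] sym_rep[OF g] by simp
    then show ?case by (simp add: RS)
  qed (simp add: R0)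
  define f where "f j = (if j < - 1 then 0 else \<sigma> j (R (nat (j + 1))))" for j
  have f: "f \<in> completion G"
  proof -
    have "\<sigma> j (R (nat (j + 1))) \<in> G j" if "\<not> j < - 1" for j
      by (rule sym_in) (use RL[of "nat (j + 1)"] that in simp)
    then show ?thesis using graded_zero by (simp add: completion_def f_def)
  qed
  have uR: "u - partial f (int k - 1) = R k" for k
  proof (induction k)
    case (Suc k)
    have "f (int k - 1) = \<sigma> (int k - 1) (R k)" by (simp add: f_def)
    then show ?case
      using Suc partial_step[of "int k - 1" f] by (simp add: RS algebra_simps)
  qed (simp add: R0)
  have "u - partial f N \<in> L N" if "N \<ge> - 1" for N
    using RL[of "nat (N + 1)"] uR[of "nat (N + 1)"] that by simp
  with f show ?thesis by (auto simp: expands_def)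
qed

lemma expands_surj:
  assumes f: "f \<in> completion G"
  shows "\<exists>u. expands u f"
proof -
  have "partial f (int (Suc k) - 1) - partial f (int k - 1) \<in> L (int k + - 1)" for k
    using partial_step[of "int k - 1" f] rep_filt[OF completionD[OF f], of "int k - 1"] by simp
  then obtain u where u: "\<And>k::nat. u - partial f (int k - 1) \<in> L (int k + - 1)"
    using filt_limit[of "\<lambda>k. partial f (int k - 1)" "-1"] by blast
  have "u - partial f N \<in> L N" if "N \<ge> - 1" for N
    using u[of "nat (N + 1)"] that by simp
  with f show ?thesis by (auto simp: expands_def)
qed

definition expansion :: "'a \<Rightarrow> int \<Rightarrow> 'g" where
  "expansion u = (THE f. expands u f)"

lemma expansion_iff: "expansion u = f \<longleftrightarrow> expands u f"
  unfolding expansion_def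
  by (metis expands_exists expands_unique_right the_equality)

lemma expands_expansion: "expands u (expansion u)"
  using expansion_iff by blast

lemma expansion_bij: "bij_betw expansion UNIV (completion G)"
proof (rule bij_betwI')
  show "expansion x = expansion y \<longleftrightarrow> x = y" for x y
    by (metis expands_expansion expands_unique_left)
  show "expansion x \<in> completion G" for x
    using expands_expansion by (simp add: expands_def)
  show "\<exists>x\<in>UNIV. f = expansion x" if "f \<in> completion G" for f
    using expands_surj[OF that] expansion_iff by (metis UNIV_I)
qed

lemma expands_add:
  assumes "expands u f" "expands v g"
  shows "expands (u + v) (\<lambda>j. f j + g j)"
  unfolding expands_def
proof (intro conjI allI impI)
  have f: "f \<in> completion G" and g: "g \<in> completion G" using assms by (simp_all add: expands_def)
  then show "(\<lambda>j. f j + g j) \<in> completion G" by (simp add: completion_def graded_add)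
  fix N :: int assume N: "- 1 \<le> N"
  have "partial (\<lambda>j. f j + g j) N = partial f N + partial g N"
    by (simp add: partial_def rep_add completionD f g sum.distrib)
  moreover have "(u - partial f N) + (v - partial g N) \<in> L N"
    by (rule filt_add) (use assms N in \<open>simp_all add: expands_def\<close>)
  ultimately show "u + v - partial (\<lambda>j. f j + g j) N \<in> L N"
    by (simp add: algebra_simps)
qed

lemma expands_scale:
  assumes "expands u f"
  shows "expands (scale c u) (\<lambda>j. gscale c (f j))"
  unfolding expands_def
proof (intro conjI allI impI)
  have f: "f \<in> completion G" using assms by (simp add: expands_def)
  then show "(\<lambda>j. gscale c (f j)) \<in> completion G" by (simp add: completion_def graded_scale)
  fix N :: int assume N: "- 1 \<le> N"
  have "partial (\<lambda>j. gscale c (f j)) N = scale c (partial f N)"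
    by (simp add: partial_def rep_scale completionD f scale_sum_right)
  moreover have "scale c (u - partial f N) \<in> L N"
    by (rule filt_scale) (use assms N in \<open>simp add: expands_def\<close>)
  ultimately show "scale c u - partial (\<lambda>j. gscale c (f j)) N \<in> L N"
    by (simp add: scale_right_diff_distrib)
qed

lemma expands_parity:
  assumes u: "expands u f"
  shows "u \<in> P p \<longleftrightarrow> f \<in> completion_parity gP G p"
proof
  have f: "f \<in> completion G" using u by (simp add: expands_def)
  {
    assume P: "u \<in> P p"
    have "f j \<in> gP p" for j
    proof (induction j rule: degree_induct)
      case (low i)
      then have "f i = 0" using graded_low[OF completionD[OF f]] by simp
      then show ?case
        using sym_in_parity[OF filt_zero subspace_0[OF parity_subspace], of i p] by simp
    next
      case (step i)
      have "u - partial f i \<in> P p"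
        by (rule subspace_diff[OF parity_subspace P partial_parity[OF f]]) (rule step)
      moreover have "u - partial f i \<in> L i" using u step(1) by (simp add: expands_def)
      ultimately have "\<sigma> i (u - partial f i) \<in> gP p" using sym_in_parity by blast
      then show ?case using expands_component[OF u step(1)] by simp
    qed
    with f show "f \<in> completion_parity gP G p" by (simp add: completion_parity_def)
  }
  assume "f \<in> completion_parity gP G p"
  then have "partial f (int k - 1) \<in> P p" for k
    by (intro partial_parity[OF f]) (simp add: completion_parity_def)
  moreover have "u - partial f (int k - 1) \<in> L (int k + - 1)" for k
    using u by (simp add: expands_def)
  ultimately show "u \<in> P p" by (rule parity_closed)
qed

lemma expands_filt:
  assumes u: "expands u f"
  shows "u \<in> L j \<longleftrightarrow> f \<in> completion_filt G j"
proof
  have f: "f \<in> completion G" using u by (simp add: expands_def)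
  {
    assume uL: "u \<in> L j"
    have "i < j \<longrightarrow> f i = 0" for i
    proof (induction i rule: degree_induct)
      case (low i)
      then show ?case using graded_low[OF completionD[OF f]] by simp
    next
      case (step i)
      show ?case
      proof
        assume i: "i < j"
        have "partial f i = 0" by (rule partial_vanish) (use step(2) i in simp)
        moreover have "u \<in> L i" "u \<in> L (i + 1)"
          using i by (auto intro: filt_mono_in[OF uL])
        ultimately show "f i = 0"
          using expands_component[OF u step(1)] sym_eq_0_iff[of u i] by simp
      qed
    qed
    with f show "f \<in> completion_filt G j" by (simp add: completion_filt_def)
  }
  assume z: "f \<in> completion_filt G j"
  show "u \<in> L j"
  proof (cases "j \<ge> - 1")
    case True
    have "partial f j = 0" by (rule partial_vanish) (use z in \<open>simp add: completion_filt_def\<close>)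
    then show ?thesis using u True by (auto simp: expands_def)
  next
    case False
    then show ?thesis by (intro filt_mono_in[OF filt_minus_one]) simp
  qed
qed

text \<open>
  Products of homogeneous elements are homogeneous, so the terms of degree \<open>k\<close> in the product of
  the two series form the homogeneous lift of the component of degree \<open>k\<close> of the bracket in the
  completion.
\<close>

lemma expands_bracket:
  assumes u: "expands u f" and v: "expands v g"
  shows "expands (br u v) (completion_bracket 1 gbr f g)"
proof -
  have f: "f \<in> completion G" and g: "g \<in> completion G" using u v by (simp_all add: expands_def)
  define x where "x i = rep i (f i)" for i
  define y where "y i = rep i (g i)" for i
  have xW: "x i \<in> homog i" and yW: "y i \<in> homog i" for i
    by (simp_all add: x_def y_def rep_in_W completionD f g)
  have xyW: "br (x i) (y l) \<in> homog (i + l)" for i l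
    by (rule homog_br[OF xW yW])
  define T where "T k = (\<Sum>i\<in>{- 1..k + 1}. br (x i) (y (k - i)))" for k
  have TW: "T k \<in> homog k" for k
  proof -
    have "br (x i) (y (k - i)) \<in> homog k" for i using xyW[of i "k - i"] by simp
    then show ?thesis unfolding T_def by (intro subspace_sum[OF homog_subspace])
  qed
  have symT: "\<sigma> k (T k) = completion_bracket 1 gbr f g k" for k
  proof -
    have "br (x i) (y (k - i)) \<in> L k" for i
      using homog_filt[OF xyW[of i "k - i"]] by simp
    moreover have "\<sigma> k (br (x i) (y (k - i))) = gbr (f i) (g (k - i))" for i
      using sym_bracket[OF homog_filt[OF xW[of i]] homog_filt[OF yW[of "k - i"]]]
      by (simp add: x_def y_def sym_rep completionD f g)
    ultimately show ?thesis
      by (simp add: T_def sym_sum completion_bracket_def)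
  qed
  have repT: "rep k (completion_bracket 1 gbr f g k) = T k" for k
    using rep_sym[OF TW] symT by simp
  show ?thesis
    unfolding expands_def
  proof (intro conjI allI impI)
    show "completion_bracket 1 gbr f g \<in> completion G"
      unfolding completion_def using symT sym_in[OF homog_filt[OF TW]] by simp
    fix N :: int assume N: "- 1 \<le> N"
    \<comment> \<open>One more term than \<open>N\<close> is needed, since a bracket with an element of \<open>L (-1)\<close> loses one step. The
      pairs of degrees in \<open>A\<close> are those of a total degree that occurs in the expansion of the
      bracket below \<open>N\<close>.\<close>
    define M where "M = N + 1"
    define B where "B = {- 1..<M} \<times> {- 1..<M}"
    define A where "A = {p \<in> B. - 1 \<le> fst p + snd p \<and> fst p + snd p < N}"
    define H where "H p = br (x (fst p)) (y (snd p))" for p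
    have M: "- 1 \<le> M" using N by (simp add: M_def)
    have 1: "br u v - br (partial f M) (partial g M) \<in> L N"
    proof -
      have "br u v - br (partial f M) (partial g M) =
          br (u - partial f M) v + br (partial f M) (v - partial g M)"
        by (simp add: br_simps)
      moreover have "br (u - partial f M) v \<in> L N"
        by (rule filt_bracket_le[of _ M _ "-1"]) (use u M in \<open>auto simp: expands_def M_def\<close>)
      moreover have "br (partial f M) (v - partial g M) \<in> L N"
        by (rule filt_bracket_le[of _ "-1" _ M]) (use v M in \<open>auto simp: expands_def M_def\<close>)
      ultimately show ?thesis by (simp add: filt_add)
    qed
    have "br (partial f M) (partial g M) = sum H B"
    proof -
      have "br (partial f M) (partial g M) = (\<Sum>i\<in>{- 1..<M}. br (x i) (partial g M))"
        by (simp add: partial_def br_sum_left x_def)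
      also have "\<dots> = (\<Sum>i\<in>{- 1..<M}. \<Sum>l\<in>{- 1..<M}. br (x i) (y l))"
        by (simp add: partial_def br_sum_right y_def)
      finally show ?thesis
        by (simp add: B_def H_def sum.cartesian_product case_prod_unfold)
    qed
    also have "\<dots> = sum H (B - A) + sum H A"
      by (rule sum.subset_diff) (auto simp: A_def B_def)
    finally have 2: "br (partial f M) (partial g M) = sum H (B - A) + sum H A" .
    have "sum H (B - A) \<in> L N"
    proof (rule filt_sum)
      fix p assume p: "p \<in> B - A"
      obtain i l where il: "p = (i, l)" by (cases p)
      show "H p \<in> L N"
      proof (cases "i + l < - 1")
        case True
        \<comment> \<open>The only such pair is \<open>i = l = - 1\<close>, where the bracket is zero.\<close>
        then show ?thesis using xyW[of i l] homog_low[of "i + l"] by (simp add: H_def il filt_zero)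
      next
        case False
        then have "N \<le> i + l" using p by (auto simp: A_def il)
        then show ?thesis using homog_filt[OF xyW] by (auto simp: H_def il intro: filt_mono_in)
      qed
    qed
    moreover have "partial (completion_bracket 1 gbr f g) N = sum H A"
    proof -
      have "partial (completion_bracket 1 gbr f g) N = (\<Sum>k\<in>{- 1..<N}. \<Sum>i\<in>{- 1..k + 1}. br (x i) (y (k - i)))"
        by (simp add: partial_def repT T_def)
      also have "\<dots> = (\<Sum>(k, i)\<in>Sigma {- 1..<N} (\<lambda>k. {- 1..k + 1}). br (x i) (y (k - i)))"
        by (rule sum.Sigma) auto
      also have "\<dots> = sum H A"
        by (rule sum.reindex_bij_witness[of _ "\<lambda>p. (fst p + snd p, fst p)" "\<lambda>(k, i). (i, k - i)"])
          (auto simp: A_def B_def H_def M_def)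
      finally show ?thesis .
    qed
    ultimately have 3: "br (partial f M) (partial g M) - partial (completion_bracket 1 gbr f g) N \<in> L N"
      by (simp add: 2)
    from filt_add[OF 1 3] show "br u v - partial (completion_bracket 1 gbr f g) N \<in> L N"
      by simp
  qed
qed

lemma image_expansion:
  assumes "\<And>u f. expands u f \<Longrightarrow> u \<in> X \<longleftrightarrow> f \<in> Y" "Y \<subseteq> completion G"
  shows "expansion ` X = Y"
proof
  show "expansion ` X \<subseteq> Y"
    using assms(1)[OF expands_expansion] by auto
  show "Y \<subseteq> expansion ` X"
  proof
    fix f assume f: "f \<in> Y"
    then obtain u where u: "expands u f" using expands_surj assms(2) by blast
    have "u \<in> X" using assms(1)[OF u] f by simp
    moreover have "expansion u = f" using u by (simp add: expansion_iff)
    ultimately show "f \<in> expansion ` X" by blast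
  qed
qed

lemma deformation_trivial: "trivial_deformation scale P br 1 L gscale gP gbr G"
  unfolding trivial_deformation_def
proof (intro exI[of _ expansion] conjI allI)
  show "bij_betw expansion UNIV (completion G)" by (rule expansion_bij)
  show "expansion (u + v) = (\<lambda>j. expansion u j + expansion v j)" for u v
    unfolding expansion_iff by (intro expands_add expands_expansion)
  show "expansion (scale c u) = (\<lambda>j. gscale c (expansion u j))" for c u
    unfolding expansion_iff by (intro expands_scale expands_expansion)
  show "expansion ` P p = completion_parity gP G p" for p
    by (rule image_expansion[OF expands_parity]) (auto simp: completion_parity_def)
  show "expansion ` L j = completion_filt G j" for j
    by (rule image_expansion[OF expands_filt]) (auto simp: completion_filt_def)
  show "expansion (br u v) = completion_bracket 1 gbr (expansion u) (expansion v)" for u v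
    unfolding expansion_iff by (intro expands_bracket expands_expansion)
qed

end


section \<open>The symbol map of a filtered deformation\<close>

context filtered_lie_superalgebra
begin

lemma coset_self: "u \<in> coset (L j) u"
  using filt_zero[of j] by (force simp: coset_def)

lemma cosetE: "x \<in> coset (L j) u \<Longrightarrow> \<exists>w\<in>L j. x = u + w"
  by (auto simp: coset_def)

lemma cosetI: "x - u \<in> L j \<Longrightarrow> x \<in> coset (L j) u"
  unfolding coset_def by (rule CollectI, rule exI[of _ "x - u"]) simp

lemma coset_eq_iff: "coset (L j) u = coset (L j) v \<longleftrightarrow> u - v \<in> L j"
proof
  assume "coset (L j) u = coset (L j) v"
  then show "u - v \<in> L j" using coset_self[of u j] cosetE[of u j v] by auto
next
  assume uv: "u - v \<in> L j"
  have sub: "coset (L j) x \<subseteq> coset (L j) y" if xy: "x - y \<in> L j" for x y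
  proof
    fix z assume "z \<in> coset (L j) x"
    then obtain w where w: "w \<in> L j" "z = x + w" using cosetE by blast
    have "x - y + w \<in> L j" by (rule filt_add[OF xy w(1)])
    then show "z \<in> coset (L j) y" by (intro cosetI) (simp add: w(2) algebra_simps)
  qed
  have "v - u \<in> L j" using filt_neg[OF uv] by simp
  with uv show "coset (L j) u = coset (L j) v" using sub by blast
qed

lemma gr_add_coset: "gr_add (coset (L j) u) (coset (L j) v) = coset (L j) (u + v)"
proof
  show "gr_add (coset (L j) u) (coset (L j) v) \<subseteq> coset (L j) (u + v)"
  proof
    fix x assume "x \<in> gr_add (coset (L j) u) (coset (L j) v)"
    then obtain a b where "a \<in> L j" "b \<in> L j" "x = u + a + (v + b)"
      unfolding gr_add_def using cosetE by blast
    then show "x \<in> coset (L j) (u + v)"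
      using filt_add[of a j b] by (intro cosetI) (simp add: algebra_simps)
  qed
  show "coset (L j) (u + v) \<subseteq> gr_add (coset (L j) u) (coset (L j) v)"
  proof
    fix x assume "x \<in> coset (L j) (u + v)"
    then obtain w where w: "w \<in> L j" "x = u + (v + w)" using cosetE by (metis add.assoc)
    then have "v + w \<in> coset (L j) v" by (intro cosetI) simp
    with w show "x \<in> gr_add (coset (L j) u) (coset (L j) v)"
      unfolding gr_add_def using coset_self by blast
  qed
qed

lemma gr_scale_coset: "gr_scale scale L j c (coset (L (j + 1)) u) = coset (L (j + 1)) (scale c u)"
proof
  show "gr_scale scale L j c (coset (L (j + 1)) u) \<subseteq> coset (L (j + 1)) (scale c u)"
  proof
    fix x assume "x \<in> gr_scale scale L j c (coset (L (j + 1)) u)"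
    then obtain a w where aw: "a \<in> L (j + 1)" "w \<in> L (j + 1)" "x = scale c (u + a) + w"
      unfolding gr_scale_def using cosetE by blast
    then have "x - scale c u = scale c a + w" by (simp add: scale_right_distrib)
    moreover have "scale c a + w \<in> L (j + 1)" by (intro filt_add filt_scale aw)
    ultimately show "x \<in> coset (L (j + 1)) (scale c u)" by (intro cosetI) (simp only:)
  qed
  show "coset (L (j + 1)) (scale c u) \<subseteq> gr_scale scale L j c (coset (L (j + 1)) u)"
    unfolding gr_scale_def using coset_self cosetE by blast
qed

lemma gr_bracket_coset:
  assumes u: "u \<in> L i" and v: "v \<in> L j"
  shows "gr_bracket br L i j (coset (L (i + 1)) u) (coset (L (j + 1)) v) = coset (L (i + j + 1)) (br u v)"
proof
  show "gr_bracket br L i j (coset (L (i + 1)) u) (coset (L (j + 1)) v) \<subseteq> coset (L (i + j + 1)) (br u v)"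
  proof
    fix x assume "x \<in> gr_bracket br L i j (coset (L (i + 1)) u) (coset (L (j + 1)) v)"
    then obtain a b w where ab: "a \<in> L (i + 1)" "b \<in> L (j + 1)" and w: "w \<in> L (i + j + 1)"
      and x: "x = br (u + a) (v + b) + w"
      unfolding gr_bracket_def using cosetE by blast
    have "b \<in> L j" using ab(2) by (rule filt_mono_in) simp
    have "br u b \<in> L (i + j + 1)" using filt_bracket_le[OF u ab(2)] by simp
    moreover have "br a (v + b) \<in> L (i + j + 1)"
      using filt_bracket_le[OF ab(1) filt_add[OF v \<open>b \<in> L j\<close>]] by simp
    ultimately have "br u b + br a (v + b) + w \<in> L (i + j + 1)"
      using w by (intro filt_add)
    moreover have "x - br u v = br u b + br a (v + b) + w"
      by (simp add: x br_simps)
    ultimately show "x \<in> coset (L (i + j + 1)) (br u v)" by (intro cosetI) (simp only:)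
  qed
  show "coset (L (i + j + 1)) (br u v) \<subseteq> gr_bracket br L i j (coset (L (i + 1)) u) (coset (L (j + 1)) v)"
    unfolding gr_bracket_def using coset_self cosetE by blast
qed

end

lemma symbol_calculus_of_gr_isomorphism:
  assumes L: "filtered_lie_superalgebra scale P br 1 L"
    and G: "acyclic_graded gscale gP gbr G d par e wt"
    and \<phi>: "gr_isomorphism scale P br L gscale gP gbr G \<phi>"
  shows "symbol_calculus scale P br L gscale gP gbr G d par e wt (\<lambda>j u. \<phi> j (coset (L (j + 1)) u))"
proof -
  interpret filtered_lie_superalgebra scale P br 1 L by (rule L)
  have bij: "bij_betw (\<phi> j) (gr_comp L j) (G j)"
    and add: "A \<in> gr_comp L j \<Longrightarrow> B \<in> gr_comp L j \<Longrightarrow> \<phi> j (gr_add A B) = \<phi> j A + \<phi> j B"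
    and sc: "A \<in> gr_comp L j \<Longrightarrow> \<phi> j (gr_scale scale L j c A) = gscale c (\<phi> j A)"
    and par: "\<phi> j ` gr_parity P L p j = G j \<inter> gP p"
    and brk: "A \<in> gr_comp L i \<Longrightarrow> B \<in> gr_comp L j \<Longrightarrow>
      \<phi> (i + j) (gr_bracket br L i j A B) = gbr (\<phi> i A) (\<phi> j B)" for i j A B c p
    using \<phi> unfolding gr_isomorphism_def by simp_all
  have comp: "coset (L (j + 1)) u \<in> gr_comp L j" if "u \<in> L j" for u j
    using that by (simp add: gr_comp_def)
  let ?\<sigma> = "\<lambda>j u. \<phi> j (coset (L (j + 1)) u)"
  have sym_add: "?\<sigma> j (u + v) = ?\<sigma> j u + ?\<sigma> j v" if "u \<in> L j" "v \<in> L j" for u v j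
    using add[OF comp[OF that(1)] comp[OF that(2)]] by (simp add: gr_add_coset)
  have zero: "?\<sigma> j 0 = 0" for j
    using sym_add[of 0 j 0] by (simp add: filt_zero)
  show ?thesis
  proof (rule symbol_calculus.intro[OF L G symbol_calculus_axioms.intro])
    fix u v :: 'a and i j :: int and c :: complex and p :: bit
    show "u \<in> L j \<Longrightarrow> v \<in> L j \<Longrightarrow> ?\<sigma> j (u + v) = ?\<sigma> j u + ?\<sigma> j v" by (rule sym_add)
    show "u \<in> L j \<Longrightarrow> ?\<sigma> j (scale c u) = gscale c (?\<sigma> j u)"
      using sc[OF comp] by (simp add: gr_scale_coset)
    show "u \<in> L j \<Longrightarrow> ?\<sigma> j u = 0 \<longleftrightarrow> u \<in> L (j + 1)"
    proof -
      assume u: "u \<in> L j"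
      have "?\<sigma> j u = 0 \<longleftrightarrow> ?\<sigma> j u = ?\<sigma> j 0" by (simp only: zero)
      also have "\<dots> \<longleftrightarrow> coset (L (j + 1)) u = coset (L (j + 1)) 0"
        using inj_on_eq_iff[OF bij_betw_imp_inj_on[OF bij] comp[OF u] comp[OF filt_zero]] .
      finally show "?\<sigma> j u = 0 \<longleftrightarrow> u \<in> L (j + 1)" by (simp add: coset_eq_iff)
    qed
    show "?\<sigma> j ` L j = G j"
      using bij_betw_imp_surj_on[OF bij[of j]] by (simp add: gr_comp_def image_image)
    show "?\<sigma> j ` (L j \<inter> P p) = G j \<inter> gP p"
      using par[of j p] by (simp add: gr_parity_def image_image)
    show "u \<in> L i \<Longrightarrow> v \<in> L j \<Longrightarrow> ?\<sigma> (i + j) (br u v) = gbr (?\<sigma> i u) (?\<sigma> j v)"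
      using brk[OF comp comp] by (simp add: gr_bracket_coset)
  qed
qed

lemma acyclic_deformation_trivial:
  assumes L: "filtered_deformation scale P br 1 L gscale gP gbr G"
    and G: "acyclic_graded gscale gP gbr G d par e wt"
  shows "trivial_deformation scale P br 1 L gscale gP gbr G"
proof -
  interpret filtered_deformation scale P br 1 L gscale gP gbr G by (rule L)
  obtain \<phi> where "gr_isomorphism scale P br L gscale gP gbr G \<phi>"
    using associated_graded by blast
  then have S: "symbol_calculus scale P br L gscale gP gbr G d par e wt (\<lambda>j u. \<phi> j (coset (L (j + 1)) u))"
    by (rule symbol_calculus_of_gr_isomorphism[OF filtered_lie_superalgebra_axioms G])
  then interpret S: symbol_calculus scale P br L gscale gP gbr G d par e wt "\<lambda>j u. \<phi> j (coset (L (j + 1)) u)" .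
  obtain D where "S.frame D" "\<And>a b. br (D a) (D b) = 0"
    using S.commuting_frame_exists by blast
  then interpret C: commuting_frame scale P br L gscale gP gbr G d par e wt "\<lambda>j u. \<phi> j (coset (L (j + 1)) u)" D
    by unfold_locales
  show ?thesis by (rule C.deformation_trivial)
qed


section \<open>Weyl and Clifford operators on the polynomial superalgebra\<close>

lemma lookup_lin_ext:
  "Poly_Mapping.lookup (lin_ext F f) m =
    (\<Sum>k\<in>Poly_Mapping.keys f. Poly_Mapping.lookup f k * Poly_Mapping.lookup (F k) m)"
  by (simp add: lin_ext_def lookup_sum lookup_lam_scale)

lemma lam_scale_scale [simp]: "lam_scale c (lam_scale d f) = lam_scale (c * d) f"
  by (rule poly_mapping_eqI) (simp add: lookup_lam_scale)

lemma lam_scale_one [simp]: "lam_scale 1 f = f"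
  by (rule poly_mapping_eqI) (simp add: lookup_lam_scale)

lemma lam_scale_uminus_left: "lam_scale (- c) f = - lam_scale c f"
  by (rule poly_mapping_eqI) (simp add: lookup_lam_scale)

lemma lam_scale_uminus_right: "lam_scale c (- f) = - lam_scale c f"
  by (rule poly_mapping_eqI) (simp add: lookup_lam_scale)

lemma lam_scale_diff_right: "lam_scale c (f - g) = lam_scale c f - lam_scale c g"
  by (rule poly_mapping_eqI) (simp add: lookup_lam_scale lookup_minus algebra_simps)

lemma lam_scale_sum_right: "lam_scale c (sum F S) = (\<Sum>s\<in>S. lam_scale c (F s))"
  by (rule poly_mapping_eqI) (simp add: lookup_lam_scale lookup_sum sum_distrib_left)

lemma lam_scale_monom [simp]: "lam_scale c (Poly_Mapping.single m d) = Poly_Mapping.single m (c * d)"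
  by (rule poly_mapping_eqI) (simp add: lookup_lam_scale lookup_single when_def)

definition lam_linear :: "('n lam \<Rightarrow> 'n lam) \<Rightarrow> bool" where
  "lam_linear A \<longleftrightarrow> (\<forall>f g. A (f + g) = A f + A g) \<and> (\<forall>c f. A (lam_scale c f) = lam_scale c (A f))"

lemma lam_linearD:
  assumes "lam_linear A"
  shows lam_linear_add: "A (f + g) = A f + A g"
    and lam_linear_scale: "A (lam_scale c f) = lam_scale c (A f)"
    and lam_linear_zero: "A 0 = 0"
    and lam_linear_uminus: "A (- f) = - A f"
    and lam_linear_diff: "A (f - g) = A f - A g"
    and lam_linear_sum: "A (sum F S) = (\<Sum>s\<in>S. A (F s))"
proof -
  show add: "A (f + g) = A f + A g" for f g using assms by (simp add: lam_linear_def)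
  show scale: "A (lam_scale c f) = lam_scale c (A f)" for c f using assms by (simp add: lam_linear_def)
  show zero: "A 0 = 0" using scale[of 0 0] by simp
  show neg: "A (- f) = - A f" for f
    using scale[of "-1" f] by (simp add: lam_scale_uminus_left)
  show "A (f - g) = A f - A g" for f g
    using add[of f "- g"] neg[of g] by simp
  show "A (sum F S) = (\<Sum>s\<in>S. A (F s))"
    by (induction S rule: infinite_finite_induct) (auto simp: zero add)
qed

lemma lam_linear_id: "lam_linear (\<lambda>f. f)"
  and lam_linear_const_zero: "lam_linear (\<lambda>f. 0)"
  by (auto simp: lam_linear_def)

lemma lam_linear_comp: "lam_linear A \<Longrightarrow> lam_linear B \<Longrightarrow> lam_linear (\<lambda>f. A (B f))"
  and lam_linear_plus: "lam_linear A \<Longrightarrow> lam_linear B \<Longrightarrow> lam_linear (\<lambda>f. A f + B f)"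
  and lam_linear_neg: "lam_linear A \<Longrightarrow> lam_linear (\<lambda>f. - A f)"
  and lam_linear_minus: "lam_linear A \<Longrightarrow> lam_linear B \<Longrightarrow> lam_linear (\<lambda>f. A f - B f)"
  and lam_linear_smult: "lam_linear A \<Longrightarrow> lam_linear (\<lambda>f. lam_scale c (A f))"
  by (auto simp: lam_linear_def lam_scale_add_right lam_scale_diff_right lam_scale_uminus_right mult.commute)

lemma lam_linear_if: "lam_linear A \<Longrightarrow> lam_linear B \<Longrightarrow> lam_linear (\<lambda>f. if b then A f else B f)"
  by (cases b) simp_all

lemma lam_linear_lin_ext: "lam_linear (lin_ext F)"
proof -
  have "lin_ext F (lam_scale c f) = lam_scale c (lin_ext F f)" for c f
  proof -
    have "Poly_Mapping.keys (lam_scale c f) \<subseteq> Poly_Mapping.keys f"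
      by (auto simp: in_keys_iff lookup_lam_scale)
    then show ?thesis
      by (subst lin_ext_superset[of "Poly_Mapping.keys f"])
        (auto simp: lin_ext_def lam_scale_sum_right lookup_lam_scale)
  qed
  then show ?thesis by (simp add: lam_linear_def lin_ext_add)
qed

lemma lam_sum_monoms:
  "f = (\<Sum>m\<in>Poly_Mapping.keys f. Poly_Mapping.single m (Poly_Mapping.lookup f m))"
proof (rule poly_mapping_eqI)
  fix k
  have "(\<Sum>m\<in>Poly_Mapping.keys f. Poly_Mapping.lookup (Poly_Mapping.single m (Poly_Mapping.lookup f m)) k)
      = (\<Sum>m\<in>Poly_Mapping.keys f. if m = k then Poly_Mapping.lookup f m else 0)"
    by (simp add: lookup_single when_def)
  then show "Poly_Mapping.lookup f k = Poly_Mapping.lookup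
      (\<Sum>m\<in>Poly_Mapping.keys f. Poly_Mapping.single m (Poly_Mapping.lookup f m)) k"
    by (simp add: lookup_sum sum.delta in_keys_iff)
qed

text \<open>
  All identities between the operators below are checked on monomials by this rule.
\<close>

lemma lam_linear_eqI:
  assumes A: "lam_linear A" and B: "lam_linear B"
    and mon: "\<And>a I c. A (lam_monom a I c) = B (lam_monom a I c)"
  shows "A f = B f"
proof -
  have "A (Poly_Mapping.single m c) = B (Poly_Mapping.single m c)" for m c
    using mon by (cases m) auto
  then have "A (\<Sum>m\<in>Poly_Mapping.keys f. Poly_Mapping.single m (Poly_Mapping.lookup f m)) =
      B (\<Sum>m\<in>Poly_Mapping.keys f. Poly_Mapping.single m (Poly_Mapping.lookup f m))"
    by (simp add: lam_linear_sum[OF A] lam_linear_sum[OF B])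
  then show ?thesis
    by (simp only: lam_sum_monoms[of f, symmetric])
qed

text \<open>
  The sign of moving \<open>\<xi>_i\<close> to its place in the ordered monomial \<open>\<xi>_I\<close>.
\<close>

definition xi_sign :: "'n::{finite,linorder} \<Rightarrow> 'n set \<Rightarrow> complex" where
  "xi_sign i I = (- 1) ^ card {j \<in> I. j < i}"

definition mult_x :: "'n::{finite,linorder} \<Rightarrow> 'n lam \<Rightarrow> 'n lam" where
  "mult_x i = lin_ext (\<lambda>(a, I). lam_monom (a(i := Suc (a i))) I 1)"

definition mult_xi :: "'n::{finite,linorder} \<Rightarrow> 'n lam \<Rightarrow> 'n lam" where
  "mult_xi i = lin_ext (\<lambda>(a, I). if i \<in> I then 0 else lam_monom a (insert i I) (xi_sign i I))"

lemma lam_linear_ops [intro, simp]: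
  "lam_linear (d_x i)" "lam_linear (d_xi i)" "lam_linear (mult_x i)" "lam_linear (mult_xi i)"
  by (simp_all add: d_x_def d_xi_def mult_x_def mult_xi_def lam_linear_lin_ext)

lemma lam_linear_ops_comp:
  assumes "lam_linear A"
  shows "lam_linear (\<lambda>f. d_x i (A f))" "lam_linear (\<lambda>f. d_xi i (A f))"
    "lam_linear (\<lambda>f. mult_x i (A f))" "lam_linear (\<lambda>f. mult_xi i (A f))"
  by (rule lam_linear_comp[OF _ assms], simp)+

lemmas lam_linear_intros = lam_linear_id lam_linear_const_zero lam_linear_plus lam_linear_minus
  lam_linear_neg lam_linear_ops_comp

lemma ops_zero [simp]: "d_x i 0 = 0" "d_xi i 0 = 0" "mult_x i 0 = 0" "mult_xi i 0 = 0"
  and ops_uminus: "d_x i (- f) = - d_x i f" "d_xi i (- f) = - d_xi i f"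
    "mult_x i (- f) = - mult_x i f" "mult_xi i (- f) = - mult_xi i f"
  using lam_linear_ops[of i] by (simp_all only: lam_linear_def) (metis add.right_neutral add_left_cancel add_eq_0_iff)+

lemma d_x_monom: "d_x i (lam_monom a I c) = lam_monom (a(i := a i - 1)) I (c * of_nat (a i))"
  and d_xi_monom: "d_xi i (lam_monom a I c) =
    (if i \<in> I then lam_monom a (I - {i}) (c * xi_sign i I) else 0)"
  and mult_x_monom: "mult_x i (lam_monom a I c) = lam_monom (a(i := Suc (a i))) I c"
  and mult_xi_monom: "mult_xi i (lam_monom a I c) =
    (if i \<in> I then 0 else lam_monom a (insert i I) (c * xi_sign i I))"
  by (simp_all add: d_x_def d_xi_def mult_x_def mult_xi_def lin_ext_single xi_sign_def)

lemma xi_sign_insert: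
  assumes "j \<notin> I"
  shows "xi_sign i (insert j I) = (if j < i then - xi_sign i I else xi_sign i I)"
proof (cases "j < i")
  case True
  then have "{k \<in> insert j I. k < i} = insert j {k \<in> I. k < i}" by auto
  with True assms show ?thesis by (simp add: xi_sign_def)
next
  case False
  then have "{k \<in> insert j I. k < i} = {k \<in> I. k < i}" by auto
  with False show ?thesis by (simp add: xi_sign_def)
qed

lemma xi_sign_remove:
  assumes "j \<in> I"
  shows "xi_sign i (I - {j}) = (if j < i then - xi_sign i I else xi_sign i I)"
  using xi_sign_insert[of j "I - {j}" i] assms by (simp add: insert_absorb split: if_splits)

lemma xi_sign_square: "xi_sign i I * xi_sign i I = 1"
  by (cases "even (card {j \<in> I. j < i})") (simp_all add: xi_sign_def)

text \<open>
  The Clifford relation. For \<open>i \<noteq> j\<close>, the operators anticommute because exactly one of the two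
  signs changes: inserting or removing the smaller index affects the sign of the larger one.
\<close>

lemma d_xi_mult_xi:
  fixes i j :: "'n::{finite,linorder}"
  shows "d_xi i (mult_xi j f) = (if i = j then f else 0) - mult_xi j (d_xi i f)"
proof (rule lam_linear_eqI[where A = "\<lambda>f. d_xi i (mult_xi j f)"
      and B = "\<lambda>f. (if i = j then f else 0) - mult_xi j (d_xi i f)"])
  fix a :: "'n \<Rightarrow> nat" and I c
  consider "i = j" "i \<in> I" | "i = j" "i \<notin> I" | "i \<noteq> j" "i \<in> I" "j \<notin> I" | "i \<noteq> j" "i \<notin> I \<or> j \<in> I"
    by blast
  then show "d_xi i (mult_xi j (lam_monom a I c)) =
      (if i = j then lam_monom a I c else 0) - mult_xi j (d_xi i (lam_monom a I c))"
  proof cases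
    case 3
    then have "insert j I - {i} = insert j (I - {i})" by auto
    with 3 show ?thesis
      by (cases rule: linorder_cases[of i j]) (auto simp: d_xi_monom mult_xi_monom xi_sign_insert xi_sign_remove
          single_uminus mult_ac dest: less_asym)
  qed (auto simp: d_xi_monom mult_xi_monom xi_sign_insert xi_sign_remove insert_absorb
      mult.assoc xi_sign_square)
qed (intro lam_linear_intros lam_linear_if)+

lemma d_xi_mult_x: "d_xi i (mult_x j f) = mult_x j (d_xi i f)"
  by (rule lam_linear_eqI[where A = "\<lambda>f. d_xi i (mult_x j f)"
      and B = "\<lambda>f. mult_x j (d_xi i f)"])
    ((intro lam_linear_intros)+, simp add: d_xi_monom mult_x_monom)

lemma d_x_mult_xi: "d_x i (mult_xi j f) = mult_xi j (d_x i f)"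
  by (rule lam_linear_eqI[where A = "\<lambda>f. d_x i (mult_xi j f)"
      and B = "\<lambda>f. mult_xi j (d_x i f)"])
    ((intro lam_linear_intros)+, simp add: d_x_monom mult_xi_monom mult_ac)

lemma d_x_mult_x:
  fixes i j :: "'n::{finite,linorder}"
  shows "d_x i (mult_x j f) = (if i = j then f else 0) + mult_x j (d_x i f)"
proof (rule lam_linear_eqI[where A = "\<lambda>f. d_x i (mult_x j f)"
      and B = "\<lambda>f. (if i = j then f else 0) + mult_x j (d_x i f)"])
  fix a :: "'n \<Rightarrow> nat" and I c
  show "d_x i (mult_x j (lam_monom a I c)) =
      (if i = j then lam_monom a I c else 0) + mult_x j (d_x i (lam_monom a I c))"
  proof (cases "i = j")
    case True
    show ?thesis
    proof (cases "a i")
      case 0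
      with True show ?thesis by (simp add: d_x_monom mult_x_monom fun_upd_idem)
    next
      case (Suc k)
      then have "a(i := Suc k) = a" by auto
      moreover have "c * of_nat (Suc (Suc k)) = c + c * of_nat (Suc k)"
        by (simp add: algebra_simps)
      ultimately show ?thesis
        using True Suc by (simp add: d_x_monom mult_x_monom single_add del: of_nat_Suc)
    qed
  next
    case False
    then show ?thesis
      by (simp add: d_x_monom mult_x_monom fun_upd_twist[of j i])
  qed
qed (intro lam_linear_intros lam_linear_if)+

text \<open>
  The generators of \<open>HO(n,n)\<close> are indexed by \<open>Inl i\<close> for \<open>x_i\<close> and \<open>Inr i\<close> for \<open>\<xi>_i\<close>. The parity
  is the reversed one.
\<close>

definition par :: "'n + 'n \<Rightarrow> bit" where
  "par s = (case s of Inl i \<Rightarrow> 1 | Inr i \<Rightarrow> 0)"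

text \<open>
  The adjoint action of the generators: \<open>x_i\<close> acts by \<open>\<partial>/\<partial>\<xi>_i\<close> and \<open>\<xi>_i\<close> by \<open>- \<partial>/\<partial>x_i\<close>. The
  operators \<open>mul s\<close> are the dual multiplications, with the sign chosen such that \<open>del_mul\<close> has no
  exceptions.
\<close>

definition del :: "'n::{finite,linorder} + 'n \<Rightarrow> 'n lam \<Rightarrow> 'n lam" where
  "del s f = (case s of Inl i \<Rightarrow> d_xi i f | Inr i \<Rightarrow> - d_x i f)"

definition mul :: "'n::{finite,linorder} + 'n \<Rightarrow> 'n lam \<Rightarrow> 'n lam" where
  "mul s f = (case s of Inl i \<Rightarrow> mult_xi i f | Inr i \<Rightarrow> - mult_x i f)"

lemma lam_linear_del [intro, simp]: "lam_linear (del s)"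
  and lam_linear_mul [intro, simp]: "lam_linear (mul s)"
  by (cases s; simp add: del_def[abs_def] mul_def[abs_def] lam_linear_neg)+

lemma del_mul:
  "del s (mul t f) = (if s = t then f else 0) + lam_scale (koszul (par s) (par t)) (mul t (del s f))"
  by (cases s; cases t) (simp_all add: del_def mul_def par_def koszul_def d_xi_mult_xi d_xi_mult_x
      d_x_mult_xi d_x_mult_x lam_scale_uminus_left ops_uminus)

definition diag :: "(('n \<Rightarrow> nat) \<times> 'n set \<Rightarrow> complex) \<Rightarrow> 'n lam \<Rightarrow> 'n lam" where
  "diag c = lin_ext (\<lambda>m. Poly_Mapping.single m (c m))"

lemma lam_linear_diag [intro, simp]: "lam_linear (diag c)"
  by (simp add: diag_def lam_linear_lin_ext)

lemma diag_monom: "diag c (lam_monom a I d) = lam_monom a I (c (a, I) * d)"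
  by (simp add: diag_def lin_ext_single mult.commute)

lemma lookup_diag: "Poly_Mapping.lookup (diag c f) m = c m * Poly_Mapping.lookup f m"
proof -
  have "Poly_Mapping.lookup (diag c f) m =
      (\<Sum>k\<in>Poly_Mapping.keys f. if k = m then c k * Poly_Mapping.lookup f k else 0)"
    unfolding diag_def lookup_lin_ext by (rule sum.cong) (auto simp: lookup_single when_def)
  then show ?thesis
    by (simp add: sum.delta in_keys_iff)
qed

lemma keys_diag: "Poly_Mapping.keys (diag c f) \<subseteq> Poly_Mapping.keys f"
  by (auto simp: in_keys_iff lookup_diag)

lemma mult_x_d_x: "mult_x i (d_x i f) = diag (\<lambda>(a, I). of_nat (a i)) f"
proof (rule lam_linear_eqI[where A = "\<lambda>f. mult_x i (d_x i f)" and B = "diag _"])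
  show "mult_x i (d_x i (lam_monom a I c)) = diag (\<lambda>(a, I). of_nat (a i)) (lam_monom a I c)" for a I c
    by (cases "a i") (auto simp: mult_x_monom d_x_monom diag_monom mult.commute fun_upd_idem)
qed (intro lam_linear_intros lam_linear_diag)+

lemma mult_xi_d_xi: "mult_xi i (d_xi i f) = diag (\<lambda>(a, I). if i \<in> I then 1 else 0) f"
proof (rule lam_linear_eqI[where A = "\<lambda>f. mult_xi i (d_xi i f)" and B = "diag _"])
  show "mult_xi i (d_xi i (lam_monom a I c)) = diag (\<lambda>(a, I). if i \<in> I then 1 else 0) (lam_monom a I c)" for a I c
    by (auto simp: mult_xi_monom d_xi_monom diag_monom xi_sign_remove insert_absorb mult.assoc xi_sign_square)
qed (intro lam_linear_intros lam_linear_diag)+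

lemma sum_indicator_card:
  fixes I :: "'n::finite set"
  shows "(\<Sum>i\<in>UNIV. if i \<in> I then 1 else 0 :: complex) = of_nat (card I)"
  by (simp add: sum.If_cases)

lemma sum_UNIV_Plus:
  fixes F :: "'a::finite + 'b::finite \<Rightarrow> 'c::comm_monoid_add"
  shows "(\<Sum>s\<in>UNIV. F s) = (\<Sum>i\<in>UNIV. F (Inl i)) + (\<Sum>i\<in>UNIV. F (Inr i))"
  by (subst UNIV_Plus_UNIV[symmetric], subst sum.Plus) simp_all

text \<open>
  The Euler field of \<open>\<Lambda>(n,n)\<close>: it multiplies a monomial by its total degree.
\<close>

lemma sum_mul_del: "(\<Sum>s\<in>UNIV. mul s (del s f)) = diag (\<lambda>(a, I). of_nat ((\<Sum>i\<in>UNIV. a i) + card I)) f"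
proof -
  have "(\<Sum>s\<in>UNIV. mul s (del s f)) = (\<Sum>i\<in>UNIV. mult_xi i (d_xi i f)) + (\<Sum>i\<in>UNIV. mult_x i (d_x i f))"
    by (simp add: sum_UNIV_Plus mul_def del_def ops_uminus)
  also have "\<dots> = diag (\<lambda>(a, I). of_nat ((\<Sum>i\<in>UNIV. a i) + card I)) f"
  proof (rule poly_mapping_eqI)
    fix m :: "('a \<Rightarrow> nat) \<times> 'a set"
    obtain a I where m: "m = (a, I)" by (cases m)
    let ?c = "Poly_Mapping.lookup f m"
    have "Poly_Mapping.lookup ((\<Sum>i\<in>UNIV. mult_xi i (d_xi i f)) + (\<Sum>i\<in>UNIV. mult_x i (d_x i f))) m =
        (\<Sum>i\<in>UNIV. (if i \<in> I then 1 else 0) * ?c) + (\<Sum>i\<in>UNIV. of_nat (a i) * ?c)"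
      by (simp add: m mult_xi_d_xi mult_x_d_x lookup_diag lookup_add lookup_sum)
    also have "\<dots> = (of_nat (card I) + (\<Sum>i\<in>UNIV. of_nat (a i))) * ?c"
      by (simp only: sum_distrib_right[symmetric] sum_indicator_card distrib_right)
    finally show "Poly_Mapping.lookup ((\<Sum>i\<in>UNIV. mult_xi i (d_xi i f)) + (\<Sum>i\<in>UNIV. mult_x i (d_x i f))) m =
        Poly_Mapping.lookup (diag (\<lambda>(a, I). of_nat ((\<Sum>i\<in>UNIV. a i) + card I)) f) m"
      by (simp add: m lookup_diag add.commute)
  qed
  finally show ?thesis .
qed

definition supported_on :: "(('n \<Rightarrow> nat) \<times> 'n set \<Rightarrow> bool) \<Rightarrow> 'n lam set" where
  "supported_on K = {f. \<forall>m\<in>Poly_Mapping.keys f. K m}"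

lemma lam_homogeneous_eq_supported:
  "lam_homogeneous d = supported_on (\<lambda>(a, I). int ((\<Sum>i\<in>UNIV. a i) + card I) = d)"
  and lam_parity_eq_supported: "lam_parity p = supported_on (\<lambda>(a, I). of_nat (card I) = p)"
  by (simp_all add: lam_homogeneous_def lam_parity_def supported_on_def)

lemma supported_on_zero [simp]: "0 \<in> supported_on K"
  and supported_on_monom: "K (a, I) \<Longrightarrow> lam_monom a I c \<in> supported_on K"
  and supported_on_add: "f \<in> supported_on K \<Longrightarrow> g \<in> supported_on K \<Longrightarrow> f + g \<in> supported_on K"
  and supported_on_uminus: "f \<in> supported_on K \<Longrightarrow> - f \<in> supported_on K"
  and supported_on_scale: "f \<in> supported_on K \<Longrightarrow> lam_scale c f \<in> supported_on K"
  using keys_add[of f g]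
  by (auto simp: supported_on_def in_keys_iff lookup_lam_scale lookup_single when_def split: if_splits)

lemma supported_on_diff: "f \<in> supported_on K \<Longrightarrow> g \<in> supported_on K \<Longrightarrow> f - g \<in> supported_on K"
  using supported_on_add[of f K "- g"] supported_on_uminus by auto

lemma supported_on_sum: "(\<And>s. s \<in> S \<Longrightarrow> F s \<in> supported_on K) \<Longrightarrow> sum F S \<in> supported_on K"
  by (induction S rule: infinite_finite_induct) (auto intro: supported_on_add)

lemma supported_on_lin_ext:
  assumes "f \<in> supported_on K" "\<And>m. K m \<Longrightarrow> F m \<in> supported_on K'"
  shows "lin_ext F f \<in> supported_on K'"
  unfolding lin_ext_def
  by (rule supported_on_sum) (use assms in \<open>auto simp: supported_on_def[of K] intro!: supported_on_scale\<close>)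

lemma supported_on_diag: "f \<in> supported_on K \<Longrightarrow> diag c f \<in> supported_on K"
  using keys_diag by (fastforce simp: supported_on_def)

lemma sum_fun_upd:
  fixes a :: "'n::finite \<Rightarrow> nat"
  shows "(\<Sum>k\<in>UNIV. (a(i := r)) k) + a i = (\<Sum>k\<in>UNIV. a k) + r"
proof -
  have "(\<Sum>k\<in>UNIV. (a(i := r)) k) = r + (\<Sum>k\<in>UNIV - {i}. (a(i := r)) k)"
    by (subst sum.remove[of _ i]) auto
  also have "(\<Sum>k\<in>UNIV - {i}. (a(i := r)) k) = (\<Sum>k\<in>UNIV - {i}. a k)"
    by (rule sum.cong) auto
  finally show ?thesis
    using sum.remove[of UNIV i a] by simp
qed

lemma mul_homogeneous:
  assumes "f \<in> lam_homogeneous d" shows "mul s f \<in> lam_homogeneous (d + 1)"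
proof (cases s)
  case (Inl i)
  have "mult_xi i f \<in> lam_homogeneous (d + 1)"
    using assms unfolding mult_xi_def lam_homogeneous_eq_supported
    by (rule supported_on_lin_ext) (auto intro!: supported_on_monom)
  with Inl show ?thesis by (simp add: mul_def)
next
  case (Inr i)
  have "mult_x i f \<in> lam_homogeneous (d + 1)"
    using assms unfolding mult_x_def lam_homogeneous_eq_supported
  proof (rule supported_on_lin_ext)
    fix m :: "('a \<Rightarrow> nat) \<times> 'a set"
    assume m: "case m of (a, I) \<Rightarrow> int ((\<Sum>i\<in>UNIV. a i) + card I) = d"
    obtain a I where [simp]: "m = (a, I)" by (cases m)
    show "(case m of (a, I) \<Rightarrow> lam_monom (a(i := Suc (a i))) I 1)
        \<in> supported_on (\<lambda>(a, I). int ((\<Sum>i\<in>UNIV. a i) + card I) = d + 1)"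
      using m sum_fun_upd[of a i "Suc (a i)"] by (auto intro!: supported_on_monom simp del: of_nat_sum)
  qed
  with Inr show ?thesis
    unfolding lam_homogeneous_eq_supported by (auto simp: mul_def intro: supported_on_uminus)
qed

lemma del_homogeneous:
  assumes "f \<in> lam_homogeneous d" shows "del s f \<in> lam_homogeneous (d - 1)"
proof (cases s)
  case (Inl i)
  have "d_xi i f \<in> lam_homogeneous (d - 1)"
    using assms unfolding d_xi_def lam_homogeneous_eq_supported
  proof (rule supported_on_lin_ext)
    fix m :: "('a \<Rightarrow> nat) \<times> 'a set"
    assume m: "case m of (a, I) \<Rightarrow> int ((\<Sum>i\<in>UNIV. a i) + card I) = d"
    obtain a I where [simp]: "m = (a, I)" by (cases m)
    show "(case m of (a, I) \<Rightarrow> if i \<in> I then lam_monom a (I - {i}) ((- 1) ^ card {j \<in> I. j < i}) else 0)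
        \<in> supported_on (\<lambda>(a, I). int ((\<Sum>i\<in>UNIV. a i) + card I) = d - 1)"
      using m card_Suc_Diff1[of I i] by (auto intro!: supported_on_monom)
  qed
  with Inl show ?thesis by (simp add: del_def)
next
  case (Inr i)
  have "d_x i f \<in> lam_homogeneous (d - 1)"
    using assms unfolding d_x_def lam_homogeneous_eq_supported
  proof (rule supported_on_lin_ext)
    fix m :: "('a \<Rightarrow> nat) \<times> 'a set"
    assume m: "case m of (a, I) \<Rightarrow> int ((\<Sum>i\<in>UNIV. a i) + card I) = d"
    obtain a I where [simp]: "m = (a, I)" by (cases m)
    show "(case m of (a, I) \<Rightarrow> lam_monom (a(i := a i - 1)) I (of_nat (a i)))
        \<in> supported_on (\<lambda>(a, I). int ((\<Sum>i\<in>UNIV. a i) + card I) = d - 1)"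
      using m sum_fun_upd[of a i "a i - 1"] by (cases "a i") (auto intro!: supported_on_monom simp del: of_nat_sum)
  qed
  with Inr show ?thesis
    unfolding lam_homogeneous_eq_supported by (auto simp: del_def intro: supported_on_uminus)
qed

lemma mul_parity:
  assumes "f \<in> lam_parity p" shows "mul s f \<in> lam_parity (p + par s)"
proof (cases s)
  case (Inl i)
  have "mult_xi i f \<in> lam_parity (p + 1)"
    using assms unfolding mult_xi_def lam_parity_eq_supported
    by (rule supported_on_lin_ext) (auto intro!: supported_on_monom simp: add.commute)
  with Inl show ?thesis by (simp add: mul_def par_def)
next
  case (Inr i)
  have "mult_x i f \<in> lam_parity p"
    using assms unfolding mult_x_def lam_parity_eq_supported
    by (rule supported_on_lin_ext) (auto intro!: supported_on_monom)
  with Inr show ?thesis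
    unfolding lam_parity_eq_supported by (auto simp: mul_def par_def intro: supported_on_uminus)
qed

lemma euler:
  assumes "f \<in> lam_homogeneous d"
  shows "(\<Sum>s\<in>UNIV. mul s (del s f)) = lam_scale (of_int d) f"
proof (unfold sum_mul_del, rule poly_mapping_eqI)
  fix m :: "('a \<Rightarrow> nat) \<times> 'a set"
  obtain a I where m: "m = (a, I)" by (cases m)
  have "of_nat ((\<Sum>i\<in>UNIV. a i) + card I) = (of_int d :: complex)" if "Poly_Mapping.lookup f (a, I) \<noteq> 0"
  proof -
    have "int ((\<Sum>i\<in>UNIV. a i) + card I) = d"
      using assms that by (auto simp: lam_homogeneous_def in_keys_iff)
    then show ?thesis by (metis of_int_of_nat_eq)
  qed
  then show "Poly_Mapping.lookup (diag (\<lambda>(a, I). of_nat ((\<Sum>i\<in>UNIV. a i) + card I)) f) m =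
      Poly_Mapping.lookup (lam_scale (of_int d) f) m"
    by (cases "Poly_Mapping.lookup f m = 0") (auto simp: m lookup_diag lookup_lam_scale)
qed


section \<open>The Poincare lemma\<close>


lemma del_sum_mul:
  "del s (\<Sum>t\<in>UNIV. mul t (F t)) =
    F s + (\<Sum>t\<in>UNIV. lam_scale (koszul (par s) (par t)) (mul t (del s (F t))))"
proof -
  have "del s (\<Sum>t\<in>UNIV. mul t (F t)) =
      (\<Sum>t\<in>UNIV. (if s = t then F t else 0) + lam_scale (koszul (par s) (par t)) (mul t (del s (F t))))"
    unfolding lam_linear_sum[OF lam_linear_del] by (rule sum.cong) (auto simp: del_mul)
  then show ?thesis by (simp add: sum.distrib)
qed

lemma poincare_zero:
  assumes "f \<in> lam_homogeneous d" "d \<noteq> 0" "\<And>s. del s f = 0"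
  shows "f = 0"
proof -
  have "lam_scale (of_int d) f = 0"
    unfolding euler[OF assms(1), symmetric] assms(3) by (simp add: lam_linear_zero[OF lam_linear_mul])
  then have "lam_scale (1 / of_int d) (lam_scale (of_int d) f) = 0"
    by (simp only: lam_scale_zero_right)
  with assms(2) show ?thesis by simp
qed

text \<open>
  Contraction with the Euler field. Moving \<open>del s\<close> past \<open>mul t\<close> leaves one copy of \<open>\<epsilon> s\<close>; in the
  remaining sum the closedness allows exchanging \<open>s\<close> and \<open>t\<close>, which produces the Euler field
  applied to \<open>\<epsilon> s\<close>.
\<close>

lemma poincare_one:
  assumes hom: "\<And>s. \<epsilon> s \<in> lam_homogeneous d"
    and closed: "\<And>s t. del s (\<epsilon> t) = lam_scale (koszul (par s) (par t)) (del t (\<epsilon> s))"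
  shows "del s (\<Sum>t\<in>UNIV. mul t (\<epsilon> t)) = lam_scale (of_int d + 1) (\<epsilon> s)"
proof -
  have "lam_scale (koszul (par s) (par t)) (mul t (del s (\<epsilon> t))) = mul t (del t (\<epsilon> s))" for t
    by (simp add: closed[of s t] lam_linear_scale[OF lam_linear_mul])
  then show ?thesis
    by (simp add: del_sum_mul euler[OF hom] lam_scale_add_left add.commute)
qed

lemma lam_scale_two: "lam_scale 2 f = f + f"
  by (simp only: one_add_one[symmetric] lam_scale_add_left lam_scale_one)

text \<open>
  As for \<open>poincare_one\<close>. The two terms \<open>del s\<close> and \<open>del t\<close> of the coboundary each leave one copy
  of \<open>\<gamma> s t\<close>, and the three-term closedness condition turns the two remaining sums into the Euler
  field applied to \<open>\<gamma> s t\<close>.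
\<close>

lemma poincare_two:
  assumes hom: "\<And>s t. \<gamma> s t \<in> lam_homogeneous d"
    and skew: "\<And>s t. \<gamma> t s = - lam_scale (koszul (par s) (par t)) (\<gamma> s t)"
    and closed: "\<And>r s t. del r (\<gamma> s t) = lam_scale (koszul (par r) (par s)) (del s (\<gamma> r t))
         - lam_scale (koszul (par r + par s) (par t)) (del t (\<gamma> r s))"
  shows "del s (\<Sum>r\<in>UNIV. mul r (\<gamma> r t)) - lam_scale (koszul (par s) (par t)) (del t (\<Sum>r\<in>UNIV. mul r (\<gamma> r s)))
    = lam_scale (of_int d + 2) (\<gamma> s t)"
proof -
  let ?k = "\<lambda>s t. koszul (par s) (par t)"
  have summand: "lam_scale (?k s r) (mul r (del s (\<gamma> r t))) - lam_scale (?k s t * ?k t r) (mul r (del t (\<gamma> r s)))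
      = mul r (del r (\<gamma> s t))" for r
    unfolding closed[of r s t] lam_linear_diff[OF lam_linear_mul] lam_linear_scale[OF lam_linear_mul]
      koszul_add_left
    by (simp add: koszul_commute mult.commute)
  have "del s (\<Sum>r\<in>UNIV. mul r (\<gamma> r t)) - lam_scale (?k s t) (del t (\<Sum>r\<in>UNIV. mul r (\<gamma> r s)))
      = \<gamma> s t - lam_scale (?k s t) (\<gamma> t s) + (\<Sum>r\<in>UNIV. mul r (del r (\<gamma> s t)))"
    unfolding summand[symmetric] del_sum_mul
    by (simp add: sum_subtractf lam_scale_add_right lam_scale_sum_right)
  also have "\<dots> = lam_scale (of_int d + 2) (\<gamma> s t)"
    by (simp add: euler[OF hom] skew[where s = s and t = t] lam_scale_uminus_right lam_scale_add_left
       lam_scale_two)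
  finally show ?thesis .
qed


section \<open>The generators and the weights of the Euler element\<close>

lemma lam_mult_monom:
  "lam_mult (lam_monom a I c) g = lam_scale c (lin_ext (\<lambda>(b, J).
     if I \<inter> J = {} then lam_monom (\<lambda>k. a k + b k) (I \<union> J) ((- 1) ^ card {(i, j). i \<in> I \<and> j \<in> J \<and> j < i})
     else 0) g)"
  by (simp add: lam_mult_def lin_ext_single)

lemma lam_mult_const_left: "lam_mult (lam_monom (\<lambda>_. 0) {} c) g = lam_scale c g"
  unfolding lam_mult_monom
  by (rule lam_linear_eqI[where A = "\<lambda>g. lam_scale c (lin_ext _ g)" and B = "lam_scale c"])
    (simp_all add: lam_linear_smult lam_linear_lin_ext lam_linear_smult[OF lam_linear_id] lin_ext_single)

lemma lam_mult_xi_left: "lam_mult (lam_monom (\<lambda>_. 0) {i} 1) g = mult_xi i g"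
proof -
  have *: "{(k, j). k = i \<and> j \<in> J \<and> j < k} = Pair i ` {j \<in> J. j < i}" for J by auto
  show ?thesis
    unfolding lam_mult_monom mult_xi_def lam_scale_one
    by (rule arg_cong[where f = "\<lambda>F. lin_ext F g"])
      (auto simp: * card_image inj_on_def xi_sign_def fun_eq_iff)
qed

lemma lam_mult_x_left: "lam_mult (lam_monom ((\<lambda>_. 0)(i := 1)) {} c) g = lam_scale c (mult_x i g)"
proof -
  have "(\<lambda>k. ((\<lambda>_. 0)(i := 1)) k + b k) = b(i := Suc (b i))" for b :: "'a \<Rightarrow> nat" by auto
  then show ?thesis
    unfolding lam_mult_monom mult_x_def by (simp add: case_prod_unfold)
qed

lemma parity_sign_monom: "parity_sign (lam_monom a I c) = lam_monom a I (c * (- 1) ^ card I)"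
  by (simp add: parity_sign_def lin_ext_single)

lemma lam_linear_parity_sign: "lam_linear parity_sign"
  by (simp add: parity_sign_def lam_linear_lin_ext)

definition var :: "'n::{finite,linorder} + 'n \<Rightarrow> 'n lam" where
  "var s = (case s of Inl i \<Rightarrow> lam_monom ((\<lambda>_. 0)(i := 1)) {} 1 | Inr i \<Rightarrow> lam_monom (\<lambda>_. 0) {i} 1)"

lemma d_x_x: "d_x k (lam_monom ((\<lambda>_. 0)(i := 1)) I c) = (if k = i then lam_monom (\<lambda>_. 0) I c else 0)"
  by (auto simp: d_x_monom intro!: arg_cong2[where f = Poly_Mapping.single])

lemma xi_sign_empty: "xi_sign i {} = 1"
  by (simp add: xi_sign_def)

lemma d_xi_xi: "d_xi k (lam_monom a {i} c) = (if k = i then lam_monom a {} c else 0)"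
proof -
  have "xi_sign i {i} = 1" using xi_sign_insert[of i "{}" i] by (simp add: xi_sign_empty)
  then show ?thesis by (auto simp: d_xi_monom)
qed

lemma buttin_var: "buttin (var s) g = del s g"
proof (cases s)
  case (Inl i)
  have "lam_mult (d_x k (var s)) (d_xi k g) + lam_mult (d_xi k (parity_sign (var s))) (d_x k g) =
      (if k = i then d_xi k g else 0)" for k
    by (simp add: Inl var_def d_x_x parity_sign_monom d_xi_monom lam_mult_const_left del: One_nat_def fun_upd_apply)
  then show ?thesis by (simp add: buttin_def Inl del_def)
next
  case (Inr i)
  have "lam_mult (d_x k (var s)) (d_xi k g) + lam_mult (d_xi k (parity_sign (var s))) (d_x k g) =
      (if k = i then - d_x k g else 0)" for k
    by (simp add: Inr var_def d_x_monom parity_sign_monom d_xi_xi lam_mult_const_left lam_scale_uminus_left)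
  then show ?thesis by (simp add: buttin_def Inr del_def)
qed

definition euler_elt :: "'n::{finite,linorder} lam" where
  "euler_elt = (\<Sum>i\<in>UNIV. lam_monom ((\<lambda>_. 0)(i := 1)) {i} 1)"

text \<open>
  The eigenvalues of the adjoint action of \<open>\<Sum> x_i \<xi>_i\<close>, see \<open>buttin_euler_elt\<close>.
\<close>

definition weight :: "('n::finite \<Rightarrow> nat) \<times> 'n set \<Rightarrow> complex" where
  "weight = (\<lambda>(a, I). of_nat (card I) - of_nat (\<Sum>i\<in>UNIV. a i))"

lemma buttin_euler_elt: "buttin euler_elt g = diag weight g"
proof -
  have dx: "d_x k euler_elt = lam_monom (\<lambda>_. 0) {k} 1" for k :: 'a
    by (simp add: euler_elt_def lam_linear_sum[OF lam_linear_ops(1)] d_x_x del: One_nat_def fun_upd_apply)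
  have dxi: "d_xi k (parity_sign euler_elt) = lam_monom ((\<lambda>_. 0)(k := 1)) {} (- 1)" for k :: 'a
    by (simp add: euler_elt_def lam_linear_sum[OF lam_linear_parity_sign] parity_sign_monom
        lam_linear_sum[OF lam_linear_ops(2)] d_xi_xi del: One_nat_def fun_upd_apply)
  have "buttin euler_elt g = (\<Sum>k\<in>UNIV. mult_xi k (d_xi k g) - mult_x k (d_x k g))"
    unfolding buttin_def dx dxi lam_mult_xi_left lam_mult_x_left by (simp add: lam_scale_uminus_left)
  also have "\<dots> = diag weight g"
  proof (rule poly_mapping_eqI)
    fix m :: "('a \<Rightarrow> nat) \<times> 'a set"
    obtain a I where m: "m = (a, I)" by (cases m)
    let ?c = "Poly_Mapping.lookup g m"
    have "Poly_Mapping.lookup (\<Sum>k\<in>UNIV. mult_xi k (d_xi k g) - mult_x k (d_x k g)) m =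
        (\<Sum>i\<in>UNIV. (if i \<in> I then 1 else 0) * ?c) - (\<Sum>i\<in>UNIV. of_nat (a i) * ?c)"
      by (simp add: m mult_xi_d_xi mult_x_d_x lookup_diag lookup_minus lookup_sum sum_subtractf)
    also have "\<dots> = (of_nat (card I) - (\<Sum>i\<in>UNIV. of_nat (a i))) * ?c"
      by (simp only: sum_distrib_right[symmetric] sum_indicator_card left_diff_distrib)
    finally show "Poly_Mapping.lookup (\<Sum>k\<in>UNIV. mult_xi k (d_xi k g) - mult_x k (d_x k g)) m =
        Poly_Mapping.lookup (diag weight g) m"
      by (simp add: m lookup_diag weight_def)
  qed
  finally show ?thesis .
qed


section \<open>Passing to the quotient by the constants\<close>

lemma abs_ho_eq_iff: "abs_ho f = abs_ho g \<longleftrightarrow> (\<exists>c. f = g + lam_const c)"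
  by (rule ho.abs_eq_iff)

lemma abs_ho_zero: "abs_ho 0 = 0"
  by (simp add: zero_ho_def)

lemma abs_ho_ops:
  "abs_ho f + abs_ho g = abs_ho (f + g)"
  "- abs_ho f = abs_ho (- f)"
  "abs_ho f - abs_ho g = abs_ho (f - g)"
  "ho_scale c (abs_ho f) = abs_ho (lam_scale c f)"
  "ho_bracket (abs_ho f) (abs_ho g) = abs_ho (buttin f g)"
  by (simp_all add: plus_ho.abs_eq uminus_ho.abs_eq minus_ho_def ho_scale.abs_eq ho_bracket.abs_eq)

lemma abs_ho_sum:
  fixes F :: "'s \<Rightarrow> 'n::{finite,linorder} lam"
  shows "(\<Sum>s\<in>S. abs_ho (F s)) = abs_ho (sum F S)"
  by (induction S rule: infinite_finite_induct) (simp_all add: abs_ho_zero abs_ho_ops)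

lemma lookup_const: "Poly_Mapping.lookup (lam_const c) m = (if m = (\<lambda>_. 0, {}) then c else 0)"
  by (simp add: lam_const_def lookup_single when_def)

lemma homogeneous_no_const: "f \<in> lam_homogeneous d \<Longrightarrow> d \<noteq> 0 \<Longrightarrow> Poly_Mapping.lookup f (\<lambda>_. 0, {}) = 0"
  by (auto simp: lam_homogeneous_def in_keys_iff dest: bspec[of _ _ "(\<lambda>_. 0, {})"])

text \<open>
  In nonzero degree there are no constants, so equations in \<open>HO(n,n)\<close> between homogeneous elements
  can be lifted to \<open>\<Lambda>(n,n)\<close>.
\<close>

lemma abs_ho_inj:
  assumes "f \<in> lam_homogeneous d" "g \<in> lam_homogeneous d" "d \<noteq> 0" "abs_ho f = abs_ho g"
  shows "f = g"
proof -
  obtain c where c: "f = g + lam_const c" using assms(4) abs_ho_eq_iff by blast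
  have "c = 0"
    using arg_cong[OF c, of "\<lambda>h. Poly_Mapping.lookup h (\<lambda>_. 0, {})"]
      homogeneous_no_const[OF assms(1,3)] homogeneous_no_const[OF assms(2,3)]
    by (simp add: lookup_add lookup_const)
  with c show ?thesis by simp
qed

lemma ho_lift: "g \<in> ho_comp k \<Longrightarrow> \<exists>f\<in>lam_homogeneous (k + 2). g = abs_ho f"
  by (auto simp: ho_comp_def)

text \<open>
  An element of \<open>HO(n,n)\<close> has a homogeneous representative and one of pure parity. They differ by
  a constant, which does not affect the parity of the homogeneous one, as it has no constant term.
\<close>

lemma ho_lift_parity:
  assumes "g \<in> ho_comp k \<inter> ho_parity p" "k + 2 \<noteq> 0"
  shows "\<exists>f\<in>lam_homogeneous (k + 2) \<inter> lam_parity (p + 1). g = abs_ho f"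
proof -
  obtain f f' where f: "f \<in> lam_homogeneous (k + 2)" "g = abs_ho f" "f' \<in> lam_parity (p + 1)" "g = abs_ho f'"
    using assms(1) by (auto simp: ho_comp_def ho_parity_def)
  then obtain c where c: "f = f' + lam_const c" using abs_ho_eq_iff by metis
  have "Poly_Mapping.keys f \<subseteq> Poly_Mapping.keys f'"
  proof
    fix m assume m: "m \<in> Poly_Mapping.keys f"
    then have "m \<noteq> (\<lambda>_. 0, {})"
      using homogeneous_no_const[OF f(1) assms(2)] by (auto simp: in_keys_iff)
    with m c show "m \<in> Poly_Mapping.keys f'" by (simp add: in_keys_iff lookup_add lookup_const)
  qed
  then have "f \<in> lam_parity (p + 1)"
    using f(3) unfolding lam_parity_eq_supported supported_on_def by blast
  with f show ?thesis by blast
qed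

lemma homogeneous_closed:
  fixes f g :: "'n::{finite,linorder} lam"
  shows "f \<in> lam_homogeneous d \<Longrightarrow> g \<in> lam_homogeneous d \<Longrightarrow> f - g \<in> lam_homogeneous d"
    and "f \<in> lam_homogeneous d \<Longrightarrow> - f \<in> lam_homogeneous d"
    and "f \<in> lam_homogeneous d \<Longrightarrow> lam_scale c f \<in> lam_homogeneous d"
    and "f \<in> lam_homogeneous d \<Longrightarrow> diag w f \<in> lam_homogeneous d"
    and "(\<And>s. s \<in> S \<Longrightarrow> F s \<in> (lam_homogeneous d :: 'n lam set)) \<Longrightarrow> sum F S \<in> lam_homogeneous d"
  unfolding lam_homogeneous_eq_supported
  by (fact supported_on_diff supported_on_uminus supported_on_scale supported_on_diag supported_on_sum)+

lemma lam_parity_closed: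
  fixes f :: "'n::{finite,linorder} lam"
  shows "f \<in> lam_parity p \<Longrightarrow> lam_scale c f \<in> lam_parity p"
    and "f \<in> lam_parity p \<Longrightarrow> diag w f \<in> lam_parity p"
    and "(\<And>s. s \<in> S \<Longrightarrow> F s \<in> (lam_parity p :: 'n lam set)) \<Longrightarrow> sum F S \<in> lam_parity p"
  unfolding lam_parity_eq_supported
  by (fact supported_on_scale supported_on_diag supported_on_sum)+

lemma del_homogeneous_shift: "f \<in> lam_homogeneous (k + 2) \<Longrightarrow> del s f \<in> lam_homogeneous (k + 1)"
  using del_homogeneous[of f "k + 2" s] by (simp add: algebra_simps)

definition gen :: "'n::{finite,linorder} + 'n \<Rightarrow> 'n ho" where
  "gen s = abs_ho (var s)"

lemma gen_bracket: "ho_bracket (gen s) (abs_ho f) = abs_ho (del s f)"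
  by (simp add: gen_def abs_ho_ops buttin_var)

lemma ho_transitive:
  assumes "0 \<le> k" "g \<in> ho_comp k" "\<And>s. ho_bracket (gen s) g = 0"
  shows "g = 0"
proof -
  obtain f where f: "f \<in> lam_homogeneous (k + 2)" "g = abs_ho f" using ho_lift[OF assms(2)] by blast
  have "del s f = 0" for s
  proof (rule abs_ho_inj)
    show "del s f \<in> lam_homogeneous (k + 1)" by (rule del_homogeneous_shift[OF f(1)])
    show "0 \<in> lam_homogeneous (k + 1)" by (simp add: lam_homogeneous_def)
    show "abs_ho (del s f) = abs_ho 0"
      using assms(3)[of s] by (simp add: f(2) gen_bracket abs_ho_zero)
  qed (use assms(1) in simp)
  then have "f = 0" using poincare_zero[OF f(1)] assms(1) by simp
  then show ?thesis using f(2) abs_ho_zero by simp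
qed

text \<open>
  The components of \<open>\<epsilon>\<close> lift to polynomials of degree \<open>k + 2\<close>. Their derivatives have degree
  \<open>k + 1 \<ge> 1\<close>, so they satisfy the closedness condition in \<open>\<Lambda>(n,n)\<close> as well, where the Poincare
  lemma applies.
\<close>

lemma ho_closed_exact_1:
  assumes k: "0 \<le> k" and hom: "\<And>s. \<epsilon> s \<in> ho_comp k"
    and closed: "\<And>s t. ho_bracket (gen s) (\<epsilon> t) = ho_scale (koszul (par s) (par t)) (ho_bracket (gen t) (\<epsilon> s))"
  shows "\<exists>\<nu>\<in>ho_comp (k + 1). \<forall>s. ho_bracket (gen s) \<nu> = \<epsilon> s"
proof -
  have "\<forall>s. \<exists>f\<in>lam_homogeneous (k + 2). \<epsilon> s = abs_ho f" using ho_lift[OF hom] by blast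
  then obtain E where E: "\<And>s. E s \<in> lam_homogeneous (k + 2)" "\<And>s. \<epsilon> s = abs_ho (E s)" by metis
  have cl: "del s (E t) = lam_scale (koszul (par s) (par t)) (del t (E s))" for s t
  proof (rule abs_ho_inj)
    have *: "del s (E t) \<in> lam_homogeneous (k + 1)" for s t
      by (rule del_homogeneous_shift[OF E(1)])
    then show "del s (E t) \<in> lam_homogeneous (k + 1)" .
    show "lam_scale (koszul (par s) (par t)) (del t (E s)) \<in> lam_homogeneous (k + 1)"
      by (intro homogeneous_closed *)
    show "abs_ho (del s (E t)) = abs_ho (lam_scale (koszul (par s) (par t)) (del t (E s)))"
      using closed[of s t] by (simp add: E(2) gen_bracket abs_ho_ops)
  qed (use k in simp)
  define N where "N = (\<Sum>t\<in>UNIV. mul t (E t))"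
  define c :: complex where "c = of_int (k + 2) + 1"
  have "c = of_int (k + 3)" by (simp add: c_def)
  then have c: "c \<noteq> 0" using k by (simp only: of_int_eq_0_iff)
  have N: "N \<in> lam_homogeneous (k + 1 + 2)"
    unfolding N_def using mul_homogeneous[OF E(1)] by (intro homogeneous_closed) (simp add: algebra_simps)
  show ?thesis
  proof (intro bexI allI)
    show "ho_bracket (gen s) (abs_ho (lam_scale (1 / c) N)) = \<epsilon> s" for s
      using poincare_one[OF E(1) cl, of s] c
      by (simp add: gen_bracket lam_linear_scale[OF lam_linear_del] E(2) c_def N_def)
    show "abs_ho (lam_scale (1 / c) N) \<in> ho_comp (k + 1)"
      unfolding ho_comp_def by (intro imageI homogeneous_closed N)
  qed
qed

text \<open>
  Lifted to \<open>\<Lambda>(n,n)\<close> like \<open>ho_closed_exact_1\<close>. The parity of the primitive is as required because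
  \<open>mul r\<close> has the parity \<open>par r\<close>.
\<close>

lemma ho_closed_exact_2:
  assumes k: "0 \<le> k" and hom: "\<And>s t. \<gamma> s t \<in> ho_comp k \<inter> ho_parity (par s + par t)"
    and skew: "\<And>s t. \<gamma> t s = - ho_scale (koszul (par s) (par t)) (\<gamma> s t)"
    and closed: "\<And>r s t. ho_bracket (gen r) (\<gamma> s t) =
        ho_scale (koszul (par r) (par s)) (ho_bracket (gen s) (\<gamma> r t))
         - ho_scale (koszul (par r + par s) (par t)) (ho_bracket (gen t) (\<gamma> r s))"
  shows "\<exists>\<nu>. (\<forall>s. \<nu> s \<in> ho_comp (k + 1) \<inter> ho_parity (par s)) \<and>
    (\<forall>s t. \<gamma> s t = ho_bracket (gen s) (\<nu> t) - ho_scale (koszul (par s) (par t)) (ho_bracket (gen t) (\<nu> s)))"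
proof -
  have "\<forall>s t. \<exists>f\<in>lam_homogeneous (k + 2) \<inter> lam_parity (par s + par t + 1). \<gamma> s t = abs_ho f"
    using ho_lift_parity[OF hom] k by simp
  then obtain C where C: "\<And>s t. C s t \<in> lam_homogeneous (k + 2)"
      "\<And>s t. C s t \<in> lam_parity (par s + par t + 1)" "\<And>s t. \<gamma> s t = abs_ho (C s t)"
    by (metis IntD1 IntD2)
  have sk: "C t s = - lam_scale (koszul (par s) (par t)) (C s t)" for s t
  proof (rule abs_ho_inj)
    show "C t s \<in> lam_homogeneous (k + 2)" by (rule C)
    show "- lam_scale (koszul (par s) (par t)) (C s t) \<in> lam_homogeneous (k + 2)"
      by (intro homogeneous_closed C)
    show "abs_ho (C t s) = abs_ho (- lam_scale (koszul (par s) (par t)) (C s t))"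
      using skew[of t s] by (simp add: C(3) abs_ho_ops)
  qed (use k in simp)
  have cl: "del r (C s t) = lam_scale (koszul (par r) (par s)) (del s (C r t))
         - lam_scale (koszul (par r + par s) (par t)) (del t (C r s))" for r s t
  proof (rule abs_ho_inj)
    have *: "del r (C s t) \<in> lam_homogeneous (k + 1)" for r s t
      by (rule del_homogeneous_shift[OF C(1)])
    then show "del r (C s t) \<in> lam_homogeneous (k + 1)" .
    show "lam_scale (koszul (par r) (par s)) (del s (C r t))
         - lam_scale (koszul (par r + par s) (par t)) (del t (C r s)) \<in> lam_homogeneous (k + 1)"
      by (intro homogeneous_closed *)
    show "abs_ho (del r (C s t)) = abs_ho (lam_scale (koszul (par r) (par s)) (del s (C r t))
         - lam_scale (koszul (par r + par s) (par t)) (del t (C r s)))"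
      using closed[of r s t] by (simp add: C(3) gen_bracket abs_ho_ops)
  qed (use k in simp)
  define N where "N t = (\<Sum>r\<in>UNIV. mul r (C r t))" for t
  define c :: complex where "c = of_int (k + 2) + 2"
  have "c = of_int (k + 4)" by (simp add: c_def)
  then have c: "c \<noteq> 0" using k by (simp only: of_int_eq_0_iff)
  have Nh: "N t \<in> lam_homogeneous (k + 1 + 2)" for t
    unfolding N_def using mul_homogeneous[OF C(1)] by (intro homogeneous_closed) (simp add: algebra_simps)
  have Np: "N t \<in> lam_parity (par t + 1)" for t
    unfolding N_def
  proof (intro lam_parity_closed)
    show "mul r (C r t) \<in> lam_parity (par t + 1)" for r
      using mul_parity[OF C(2)[of r t], of r] by (cases "par r"; cases "par t") simp_all
  qed
  have eq: "C s t = del s (lam_scale (1 / c) (N t)) -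
      lam_scale (koszul (par s) (par t)) (del t (lam_scale (1 / c) (N s)))" for s t
  proof -
    have "lam_scale (1 / c) (del s (N t) - lam_scale (koszul (par s) (par t)) (del t (N s))) = C s t"
      using poincare_two[of C, OF C(1) sk cl, of s t] c by (simp add: c_def N_def)
    then show ?thesis
      by (simp add: lam_linear_scale[OF lam_linear_del] lam_scale_diff_right mult.commute)
  qed
  show ?thesis
  proof (intro exI conjI allI)
    show "abs_ho (lam_scale (1 / c) (N s)) \<in> ho_comp (k + 1) \<inter> ho_parity (par s)" for s
      unfolding ho_comp_def ho_parity_def
      by (intro IntI imageI homogeneous_closed lam_parity_closed Nh Np)
    show "\<gamma> s t = ho_bracket (gen s) (abs_ho (lam_scale (1 / c) (N t)))
        - ho_scale (koszul (par s) (par t)) (ho_bracket (gen t) (abs_ho (lam_scale (1 / c) (N s))))" for s t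
      unfolding gen_bracket abs_ho_ops C(3) eq[symmetric] ..
  qed
qed

lemma gen_in: "gen s \<in> ho_comp (- 1) \<inter> ho_parity (par s)"
proof -
  have "var s \<in> lam_homogeneous (- 1 + 2)"
    by (cases s) (simp_all add: var_def lam_homogeneous_def del: of_nat_sum)
  moreover have "var s \<in> lam_parity (par s + 1)"
    by (cases s) (simp_all add: var_def lam_parity_def par_def)
  ultimately show ?thesis unfolding gen_def ho_comp_def ho_parity_def by blast
qed

lemma homogeneous_zero_const:
  fixes f :: "'n::{finite,linorder} lam"
  assumes f: "f \<in> lam_homogeneous 0"
  shows "\<exists>c. f = lam_const c"
proof (intro exI poly_mapping_eqI)
  fix m :: "('n \<Rightarrow> nat) \<times> 'n set"
  show "Poly_Mapping.lookup f m = Poly_Mapping.lookup (lam_const (Poly_Mapping.lookup f (\<lambda>_. 0, {}))) m"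
  proof (cases "m \<in> Poly_Mapping.keys f")
    case True
    obtain a I where m: "m = (a, I)" by (cases m)
    have "int ((\<Sum>i\<in>UNIV. a i) + card I) = 0"
      using f True m unfolding lam_homogeneous_def by blast
    then have "(\<Sum>i\<in>UNIV. a i) = 0 \<and> card I = 0" by linarith
    then have "m = (\<lambda>_. 0, {})" by (simp add: m fun_eq_iff)
    then show ?thesis by (simp add: lookup_const)
  qed (auto simp: in_keys_iff lookup_const)
qed

text \<open>
  The Euler identity writes a linear polynomial as the sum of the \<open>mul s\<close> applied to its
  derivatives, which are constants.
\<close>

lemma gen_span:
  assumes "g \<in> ho_comp (- 1)"
  shows "\<exists>c. g = (\<Sum>s\<in>UNIV. ho_scale (c s) (gen s))"
proof -
  obtain f where f: "f \<in> lam_homogeneous 1" "g = abs_ho f" using ho_lift[OF assms] by auto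
  have "\<exists>c. del s f = lam_const c" for s
    using del_homogeneous[OF f(1), of s] by (intro homogeneous_zero_const) simp
  then obtain c where c: "\<And>s. del s f = lam_const (c s)" by metis
  have mul_l: "mul (Inl i) (lam_const z) = lam_scale z (var (Inr i))" for i :: 'a and z
    by (simp add: mul_def var_def lam_const_def mult_xi_monom xi_sign_def)
  have mul_r: "mul (Inr i) (lam_const z) = lam_scale (- z) (var (Inl i))" for i :: 'a and z
    by (simp add: mul_def var_def lam_const_def mult_x_monom single_uminus)
  \<comment> \<open>The action of \<open>x_i\<close> extracts the coefficient of \<open>\<xi>_i\<close>, that of \<open>\<xi>_i\<close> the one of \<open>x_i\<close> up to sign.\<close>
  define c' where "c' s = (case s of Inl i \<Rightarrow> - c (Inr i) | Inr i \<Rightarrow> c (Inl i))" for s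
  have "f = (\<Sum>s\<in>UNIV. mul s (lam_const (c s)))"
    using euler[OF f(1)] by (simp add: c)
  also have "\<dots> = (\<Sum>i\<in>UNIV. lam_scale (c (Inl i)) (var (Inr i))) + (\<Sum>i\<in>UNIV. lam_scale (- c (Inr i)) (var (Inl i)))"
    by (simp add: sum_UNIV_Plus mul_l mul_r)
  also have "\<dots> = (\<Sum>s\<in>UNIV. lam_scale (c' s) (var s))"
    by (simp add: sum_UNIV_Plus c'_def add.commute)
  finally have f_eq: "f = (\<Sum>s\<in>UNIV. lam_scale (c' s) (var s))" .
  have "g = (\<Sum>s\<in>UNIV. ho_scale (c' s) (gen s))"
    unfolding f(2) gen_def abs_ho_ops abs_ho_sum f_eq[symmetric] ..
  then show ?thesis by blast
qed

definition eul :: "'n::{finite,linorder} ho" where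
  "eul = abs_ho euler_elt"

definition wt :: "'n + 'n \<Rightarrow> complex" where
  "wt s = (case s of Inl i \<Rightarrow> - 1 | Inr i \<Rightarrow> 1)"

lemma eul_bracket: "ho_bracket eul (abs_ho f) = abs_ho (diag weight f)"
  by (simp add: eul_def abs_ho_ops buttin_euler_elt)

lemma eul_in: "eul \<in> ho_comp 0 \<inter> ho_parity 0"
proof -
  have "euler_elt \<in> lam_homogeneous (0 + 2)"
    unfolding euler_elt_def by (intro homogeneous_closed) (simp add: lam_homogeneous_def del: of_nat_sum)
  moreover have "euler_elt \<in> lam_parity (0 + 1)"
    unfolding euler_elt_def by (intro lam_parity_closed) (simp add: lam_parity_def)
  ultimately show ?thesis unfolding eul_def ho_comp_def ho_parity_def by blast
qed

lemma eul_gen: "ho_bracket eul (gen s) = ho_scale (wt s) (gen s)"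
proof -
  have "diag weight (var s) = lam_scale (wt s) (var s)"
  proof -
    have "(\<Sum>k\<in>UNIV. ((\<lambda>_. 0)(i := 1)) k) = (1 :: nat)" for i :: 'a
      using sum_fun_upd[of "\<lambda>_. 0" i 1] by simp
    then show ?thesis
      by (cases s) (simp_all add: var_def diag_monom weight_def wt_def del: fun_upd_apply of_nat_sum One_nat_def)
  qed
  then show ?thesis by (simp add: gen_def eul_bracket abs_ho_ops)
qed

text \<open>
  The weights of \<open>G (-1)\<close> are \<open>1\<close> and \<open>- 1\<close>; those of \<open>G 0\<close>, in the next lemma, are \<open>- 2\<close>, \<open>0\<close> and
  \<open>2\<close>.
\<close>

lemma weight_degree_one:
  assumes "int ((\<Sum>i\<in>UNIV. a i) + card I) = 1"
  shows "weight (a, I) \<noteq> wt s + wt t"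
proof -
  have "(\<Sum>i\<in>UNIV. a i) = 0 \<and> card I = 1 \<or> (\<Sum>i\<in>UNIV. a i) = 1 \<and> card I = 0"
    using assms by linarith
  then show ?thesis
    by (cases s; cases t) (auto simp: weight_def wt_def simp del: sum_eq_0_iff of_nat_sum)
qed

lemma weight_degree_two:
  assumes "int ((\<Sum>i\<in>UNIV. a i) + card I) = 2"
  shows "weight (a, I) \<noteq> wt s"
proof -
  have "(\<Sum>i\<in>UNIV. a i) = 0 \<and> card I = 2 \<or> (\<Sum>i\<in>UNIV. a i) = 1 \<and> card I = 1 \<or> (\<Sum>i\<in>UNIV. a i) = 2 \<and> card I = 0"
    using assms by linarith
  then show ?thesis
    by (cases s) (auto simp: weight_def wt_def simp del: sum_eq_0_iff of_nat_sum)
qed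

lemma eul_minus_one:
  assumes "g \<in> ho_comp (- 1)" "ho_bracket eul g = ho_scale (wt s + wt t) g"
  shows "g = 0"
proof -
  obtain f where f: "f \<in> lam_homogeneous 1" "g = abs_ho f" using ho_lift[OF assms(1)] by auto
  have "diag weight f = lam_scale (wt s + wt t) f"
  proof (rule abs_ho_inj)
    show "diag weight f \<in> lam_homogeneous 1" "lam_scale (wt s + wt t) f \<in> lam_homogeneous 1"
      by (intro homogeneous_closed f)+
    show "abs_ho (diag weight f) = abs_ho (lam_scale (wt s + wt t) f)"
      using assms(2) by (simp add: f(2) eul_bracket abs_ho_ops)
  qed simp
  then have *: "weight m * Poly_Mapping.lookup f m = (wt s + wt t) * Poly_Mapping.lookup f m" for m
    by (metis lookup_diag lookup_lam_scale)
  have "f = 0"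
  proof (rule poly_mapping_eqI)
    fix m :: "('a \<Rightarrow> nat) \<times> 'a set"
    show "Poly_Mapping.lookup f m = Poly_Mapping.lookup 0 m"
    proof (rule ccontr)
      assume "\<not> ?thesis"
      then have m: "Poly_Mapping.lookup f m \<noteq> 0" by simp
      obtain a I where aI: "m = (a, I)" by (cases m)
      have "int ((\<Sum>i\<in>UNIV. a i) + card I) = 1"
        using f(1) m by (auto simp: lam_homogeneous_def in_keys_iff aI)
      then have "weight m \<noteq> wt s + wt t" unfolding aI by (rule weight_degree_one)
      with *[of m] m show False by simp
    qed
  qed
  then show ?thesis using f(2) abs_ho_zero by simp
qed

text \<open>
  Solving for \<open>v\<close> amounts to dividing each coefficient by \<open>weight m - wt s\<close>, which is an odd
  number on the monomials \<open>m\<close> of degree two. A diagonal operator preserves the degree and the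
  parity.
\<close>

lemma eul_zero:
  assumes "g \<in> ho_comp 0 \<inter> ho_parity p"
  shows "\<exists>v\<in>ho_comp 0 \<inter> ho_parity p. ho_bracket eul v - ho_scale (wt s) v = g"
proof -
  obtain f where f: "f \<in> lam_homogeneous (0 + 2)" "f \<in> lam_parity (p + 1)" "g = abs_ho f"
    using ho_lift_parity[OF assms] by auto
  define v where "v = diag (\<lambda>m. 1 / (weight m - wt s)) f"
  have "diag weight v - lam_scale (wt s) v = f"
  proof (rule poly_mapping_eqI)
    fix m :: "('a \<Rightarrow> nat) \<times> 'a set"
    obtain a I where aI: "m = (a, I)" by (cases m)
    show "Poly_Mapping.lookup (diag weight v - lam_scale (wt s) v) m = Poly_Mapping.lookup f m"
    proof (cases "Poly_Mapping.lookup f m = 0")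
      case False
      then have "int ((\<Sum>i\<in>UNIV. a i) + card I) = 2"
        using f(1) by (auto simp: lam_homogeneous_def in_keys_iff aI)
      then have "weight m - wt s \<noteq> 0" using weight_degree_two[of a I s] by (simp add: aI)
      then show ?thesis
        by (simp add: v_def lookup_diag lookup_minus lookup_lam_scale left_diff_distrib[symmetric] flip: diff_divide_distrib)
    qed (simp add: v_def lookup_diag lookup_minus lookup_lam_scale)
  qed
  moreover have "v \<in> lam_homogeneous (0 + 2)" "v \<in> lam_parity (p + 1)"
    unfolding v_def by (intro homogeneous_closed lam_parity_closed f)+
  ultimately show ?thesis
    unfolding ho_comp_def ho_parity_def
    by (intro bexI[of _ "abs_ho v"]) (auto simp: eul_bracket abs_ho_ops f(3))
qed

lemma ho_acyclic:
  "acyclic_graded ho_scale ho_parity ho_bracket ho_comp (gen :: 'n::{finite,linorder} + 'n \<Rightarrow> 'n ho) par eul wt"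
proof (rule acyclic_graded.intro)
  fix k :: int and g :: "'n ho" and \<epsilon> :: "'n + 'n \<Rightarrow> 'n ho" and \<gamma> :: "'n + 'n \<Rightarrow> 'n + 'n \<Rightarrow> 'n ho"
    and s t :: "'n + 'n"
  show "gen s \<in> ho_comp (- 1) \<inter> ho_parity (par s)" by (rule gen_in)
  show "g \<in> ho_comp (- 1) \<Longrightarrow> \<exists>c. g = (\<Sum>s\<in>UNIV. ho_scale (c s) (gen s))" by (rule gen_span)
  show "0 \<le> k \<Longrightarrow> g \<in> ho_comp k \<Longrightarrow> (\<And>s. ho_bracket (gen s) g = 0) \<Longrightarrow> g = 0" by (rule ho_transitive)
  show "0 \<le> k \<Longrightarrow> (\<And>s. \<epsilon> s \<in> ho_comp k) \<Longrightarrow>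
      (\<And>s t. ho_bracket (gen s) (\<epsilon> t) = ho_scale (koszul (par s) (par t)) (ho_bracket (gen t) (\<epsilon> s))) \<Longrightarrow>
      \<exists>\<nu>\<in>ho_comp (k + 1). \<forall>s. ho_bracket (gen s) \<nu> = \<epsilon> s" by (rule ho_closed_exact_1)
  show "0 \<le> k \<Longrightarrow> (\<And>s t. \<gamma> s t \<in> ho_comp k \<inter> ho_parity (par s + par t)) \<Longrightarrow>
      (\<And>s t. \<gamma> t s = - ho_scale (koszul (par s) (par t)) (\<gamma> s t)) \<Longrightarrow>
      (\<And>r s t. ho_bracket (gen r) (\<gamma> s t) =
        ho_scale (koszul (par r) (par s)) (ho_bracket (gen s) (\<gamma> r t))
         - ho_scale (koszul (par r + par s) (par t)) (ho_bracket (gen t) (\<gamma> r s))) \<Longrightarrow>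
      \<exists>\<nu>. (\<forall>s. \<nu> s \<in> ho_comp (k + 1) \<inter> ho_parity (par s)) \<and>
        (\<forall>s t. \<gamma> s t = ho_bracket (gen s) (\<nu> t) - ho_scale (koszul (par s) (par t)) (ho_bracket (gen t) (\<nu> s)))"
    by (rule ho_closed_exact_2)
  show "eul \<in> ho_comp 0 \<inter> ho_parity 0" by (rule eul_in)
  show "ho_bracket eul (gen s) = ho_scale (wt s) (gen s)" by (rule eul_gen)
  show "g \<in> ho_comp (- 1) \<Longrightarrow> ho_bracket eul g = ho_scale (wt s + wt t) g \<Longrightarrow> g = 0"
    by (rule eul_minus_one)
  show "g \<in> ho_comp 0 \<inter> ho_parity (par s) \<Longrightarrow>
      \<exists>v\<in>ho_comp 0 \<inter> ho_parity (par s). ho_bracket eul v - ho_scale (wt s) v = g"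
    by (rule eul_zero)
qed

theorem theorem4p2:
  fixes scale :: "complex \<Rightarrow> 'a::ab_group_add \<Rightarrow> 'a"
    and P :: "bit \<Rightarrow> 'a set"
    and br :: "'a \<Rightarrow> 'a \<Rightarrow> 'a"
    and L :: "int \<Rightarrow> 'a set"
  assumes "CARD('n::{finite,linorder}) \<ge> 2"
    and "filtered_deformation scale P br 1 L
      ho_scale ho_parity ho_bracket (ho_comp :: int \<Rightarrow> 'n ho set)"
  shows "trivial_deformation scale P br 1 L
      ho_scale ho_parity ho_bracket (ho_comp :: int \<Rightarrow> 'n ho set)"
  using assms(2) ho_acyclic by (rule acyclic_deformation_trivial)

end
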